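(* Let $\mathcal X$ be a reflexive real Banach space with topological dual $\mathcal X^*$. Let $f\in\Gamma_0(\mathcal X)$ be a Legendre function, let $\varphi\in\Gamma_0(\mathcal X)$ be such that $0\in\operatorname{sri}(\operatorname{dom} f^*-\operatorname{dom}\varphi^* )$, and let $x\in(\operatorname{int}\operatorname{dom} f)\cap\operatorname{int}(\operatorname{dom} f+\operatorname{dom}\varphi)$. Then the following hold. (i) $f(x)=(\varphi\,\square\, f)(x)+(\varphi^*\diamond f^* )\big(\nabla f(x)\big)$. (ii) $x=\operatorname{aprox}^f_\varphi x+\nabla f^*\big(\operatorname{bprox}^{f^*}_{\varphi^*}(\nabla f(x))\big)$. (iii) $\big\langle \operatorname{aprox}^f_\varphi x,\operatorname{bprox}^{f^*}_{\varphi^*}(\nabla f(x))\big\rangle=\varphi\big(\operatorname{aprox}^f_\varphi x\big)+\varphi^*\big(\operatorname{bprox}^{f^*}_{\varphi^*}(\nabla f(x))\big)$. (iv) $\big\langle \operatorname{aprox}^f_\varphi x,\nabla f(x-\operatorname{aprox}^f_\varphi x)\big\rangle=\varphi\big(\operatorname{aprox}^f_\varphi x\big)+\varphi^*\big(\nabla f(x-\operatorname{aprox}^f_\varphi x)\big)$.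
   Context: $\langle\cdot,\cdot\rangle$ is the canonical bilinear form on $\mathcal X\times\mathcal X^*$, and $\mathcal X^{**}$ is identified with $\mathcal X$. $\Gamma_0(\mathcal X)$ is the class of lower semicontinuous convex functions $\varphi:\mathcal X\to\,]-\infty,+\infty]$ with $\operatorname{dom}\varphi=\{x:\varphi(x)<+\infty\}\neq\varnothing$. The conjugate of $\varphi$ is $\varphi^*(x^* )=\sup_{x\in\mathcal X}(\langle x,x^*\rangle-\varphi(x))$ for $x^*\in\mathcal X^*$. The subdifferential of $\varphi$ is $\partial\varphi$. The infimal convolution is $(\varphi\,\square\, f)(x)=\inf_{y\in\mathcal X}(\varphi(y)+f(x-y))$. The strong relative interior of a convex set $C$ is $\operatorname{sri}C=\{x\in C:\bigcup_{\lambda>0}\lambda(C-x)=\overline{\operatorname{span}}(C-x)\}$. Legendre functions: $f\in\Gamma_0(\mathcal X)$ is essentially smooth if $\partial f$ is both locally bounded and single-valued on its domain; essentially strictly convex if $(\partial f)^{-1}$ is locally bounded on its domain and $f$ is strictly convex on every convex subset of $\operatorname{dom}\partial f$; Legendre if it is both. For a Legendre function $f$ it is known that $f^*$ is Legendre, that $\operatorname{dom}\partial f=\operatorname{int}\operatorname{dom}f\neq\varnothing$, that $f$ is Gâteaux differentiable on $\operatorname{int}\operatorname{dom} f$ with gradient $\nabla f$, and that $\nabla f:\operatorname{int}\operatorname{dom}f\to\operatorname{int}\operatorname{dom}f^*$ is a bijection with inverse $\nabla f^*$. Bregman distance: for $f$ Legendre, $D_f(y,x)=f(y)-f(x)-\langle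 y-x,\nabla f(x)\rangle$ if $x\in\operatorname{int}\operatorname{dom}f$, and $D_f(y,x)=+\infty$ otherwise. For $\varphi\in\Gamma_0(\mathcal X)$, $(\varphi\diamond f)(x)=\inf_{y\in\mathcal X}(\varphi(y)+D_f(y,x))$. Bregman proximity operator: if $f\in\Gamma_0(\mathcal X)$ is Legendre, $\varphi\in\Gamma_0(\mathcal X)$, and $0\in\operatorname{sri}(\operatorname{dom}f-\operatorname{dom}\varphi)$, then for every $x\in\operatorname{int}\operatorname{dom}f$ with $\nabla f(x)\in\operatorname{int}(\operatorname{dom}f^*+\operatorname{dom}\varphi^* )$, $\operatorname{bprox}^f_\varphi x$ is the unique minimizer over $y\in\mathcal X$ of $\varphi(y)+D_f(y,x)$ (it exists and lies in $\operatorname{int}\operatorname{dom}f$). Anisotropic proximity operator: if $f\in\Gamma_0(\mathcal X)$ is Legendre, $\varphi\in\Gamma_0(\mathcal X)$, and $0\in\operatorname{sri}(\operatorname{dom}f^*-\operatorname{dom}\varphi^* )$, then for every $x\in\operatorname{sri}(\operatorname{dom}f+\operatorname{dom}\varphi)$, $\operatorname{aprox}^f_\varphi x$ is the unique minimizer over $y\in\mathcal X$ of $\varphi(y)+f(x-y)$ (it exists). The objects $\varphi^*\diamond f^*$ and $\operatorname{bprox}^{f^*}_{\varphi^*}$ are those obtained by applying these definitions on the space $\mathcal X^*$ to $f^*$ and $\varphi^*$ (with $\mathcal X^{**}=\mathcal X$, $f^{**}=f$, $\varphi^{**}=\varphi$). *)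

theory Defs
  imports "HOL-Analysis.Analysis"
begin

text \<open>
  The dual of a real normed space \<open>'a\<close> is the type \<open>'a \<Rightarrow>\<^sub>L real\<close> with the operator norm, and
  the pairing of \<open>x\<close> with \<open>x'\<close> is \<open>blinfun_apply x' x\<close>. Functions with values in
  \<open>]-\<infinity>, +\<infinity>]\<close> are \<open>ereal\<close>-valued functions that omit \<open>-\<infinity>\<close>. All notions are defined on an
  arbitrary real normed space, so that they apply verbatim to the dual space; the gradient of
  a function on the dual is then an element of the bidual.
\<close>

lift_definition bidual_embed ::
  "'a::real_normed_vector \<Rightarrow> ('a \<Rightarrow>\<^sub>L real) \<Rightarrow>\<^sub>L real"
  is "\<lambda>x x'. blinfun_apply x' x"
  by (rule bounded_bilinear.bounded_linear_left[OF bounded_bilinear_blinfun_apply])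

definition reflexive_space :: "'a::real_normed_vector itself \<Rightarrow> bool" where
  "reflexive_space _ \<longleftrightarrow>
     surj (bidual_embed :: 'a \<Rightarrow> ('a \<Rightarrow>\<^sub>L real) \<Rightarrow>\<^sub>L real)"

text \<open>The identification of the bidual of a reflexive space with the space itself.\<close>

definition of_bidual :: "(('a::real_normed_vector \<Rightarrow>\<^sub>L real) \<Rightarrow>\<^sub>L real) \<Rightarrow> 'a" where
  "of_bidual = inv bidual_embed"

definition eff_dom :: "('a \<Rightarrow> ereal) \<Rightarrow> 'a set" where
  "eff_dom \<phi> = {x. \<phi> x < \<infinity>}"

definition lsc :: "('a::topological_space \<Rightarrow> ereal) \<Rightarrow> bool" where
  "lsc \<phi> \<longleftrightarrow> (\<forall>x. \<phi> x \<le> Liminf (at x) \<phi>)"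

definition convex_fun :: "('a::real_vector \<Rightarrow> ereal) \<Rightarrow> bool" where
  "convex_fun \<phi> \<longleftrightarrow>
     (\<forall>x y t. 0 < t \<longrightarrow> t < 1 \<longrightarrow>
        \<phi> ((1 - t) *\<^sub>R x + t *\<^sub>R y) \<le> ereal (1 - t) * \<phi> x + ereal t * \<phi> y)"

definition Gamma0 :: "('a::real_normed_vector \<Rightarrow> ereal) set" where
  "Gamma0 = {\<phi>. lsc \<phi> \<and> convex_fun \<phi> \<and> (\<forall>x. \<phi> x \<noteq> -\<infinity>) \<and> eff_dom \<phi> \<noteq> {}}"

definition conjugate ::
  "('a::real_normed_vector \<Rightarrow> ereal) \<Rightarrow> ('a \<Rightarrow>\<^sub>L real) \<Rightarrow> ereal" where
  "conjugate \<phi> x' = (SUP x. ereal (blinfun_apply x' x) - \<phi> x)"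

definition subdiff ::
  "('a::real_normed_vector \<Rightarrow> ereal) \<Rightarrow> 'a \<Rightarrow> ('a \<Rightarrow>\<^sub>L real) set" where
  "subdiff \<phi> x = {x'. \<forall>y. \<phi> x + ereal (blinfun_apply x' (y - x)) \<le> \<phi> y}"

definition inf_conv ::
  "('a::real_normed_vector \<Rightarrow> ereal) \<Rightarrow> ('a \<Rightarrow> ereal) \<Rightarrow> 'a \<Rightarrow> ereal" where
  "inf_conv \<phi> f x = (INF y. \<phi> y + f (x - y))"

definition minkowski_sum :: "'a::ab_group_add set \<Rightarrow> 'a set \<Rightarrow> 'a set" where
  "minkowski_sum A B = {a + b | a b. a \<in> A \<and> b \<in> B}"

definition minkowski_diff :: "'a::ab_group_add set \<Rightarrow> 'a set \<Rightarrow> 'a set" where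
  "minkowski_diff A B = {a - b | a b. a \<in> A \<and> b \<in> B}"

definition sri :: "'a::real_normed_vector set \<Rightarrow> 'a set" where
  "sri C = {x \<in> C. (\<Union>l\<in>{0<..}. (\<lambda>c. l *\<^sub>R (c - x)) ` C) = closure (span ((\<lambda>c. c - x) ` C))}"

text \<open>Set-valued operators are functions into sets; their domain is where they are nonempty.\<close>

definition op_dom :: "('a \<Rightarrow> 'b set) \<Rightarrow> 'a set" where
  "op_dom A = {x. A x \<noteq> {}}"

definition op_inverse :: "('a \<Rightarrow> 'b set) \<Rightarrow> 'b \<Rightarrow> 'a set" where
  "op_inverse A y = {x. y \<in> A x}"

definition locally_bounded_on_dom ::
  "('a::real_normed_vector \<Rightarrow> 'b::real_normed_vector set) \<Rightarrow> bool" where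
  "locally_bounded_on_dom A \<longleftrightarrow>
     (\<forall>x \<in> op_dom A. \<exists>r>0. bounded (\<Union>z\<in>ball x r. A z))"

definition single_valued_on_dom :: "('a \<Rightarrow> 'b set) \<Rightarrow> bool" where
  "single_valued_on_dom A \<longleftrightarrow> (\<forall>x \<in> op_dom A. \<exists>!y. y \<in> A x)"

definition strictly_convex_fun_on :: "'a::real_vector set \<Rightarrow> ('a \<Rightarrow> ereal) \<Rightarrow> bool" where
  "strictly_convex_fun_on C f \<longleftrightarrow>
     (\<forall>x\<in>C. \<forall>y\<in>C. \<forall>t. x \<noteq> y \<longrightarrow> 0 < t \<longrightarrow> t < 1 \<longrightarrow>
        f ((1 - t) *\<^sub>R x + t *\<^sub>R y) < ereal (1 - t) * f x + ereal t * f y)"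

definition essentially_smooth :: "('a::real_normed_vector \<Rightarrow> ereal) \<Rightarrow> bool" where
  "essentially_smooth f \<longleftrightarrow>
     locally_bounded_on_dom (subdiff f) \<and> single_valued_on_dom (subdiff f)"

definition essentially_strictly_convex :: "('a::real_normed_vector \<Rightarrow> ereal) \<Rightarrow> bool" where
  "essentially_strictly_convex f \<longleftrightarrow>
     locally_bounded_on_dom (op_inverse (subdiff f)) \<and>
     (\<forall>C. convex C \<longrightarrow> C \<subseteq> op_dom (subdiff f) \<longrightarrow> strictly_convex_fun_on C f)"

definition legendre :: "('a::real_normed_vector \<Rightarrow> ereal) \<Rightarrow> bool" where
  "legendre f \<longleftrightarrow>
     f \<in> Gamma0 \<and> essentially_smooth f \<and> essentially_strictly_convex f"

text \<open>
  The Gateaux gradient, meaningful at points of the interior of the domain where \<open>f\<close> is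
  Gateaux differentiable. There \<open>f\<close> is real-valued near \<open>x\<close>, so that \<open>real_of_ereal\<close>
  loses no information in the limit.
\<close>

definition has_gateaux_gradient ::
  "('a::real_normed_vector \<Rightarrow> ereal) \<Rightarrow> 'a \<Rightarrow> ('a \<Rightarrow>\<^sub>L real) \<Rightarrow> bool" where
  "has_gateaux_gradient f x g \<longleftrightarrow>
     x \<in> interior (eff_dom f) \<and>
     (\<forall>h. ((\<lambda>t. (real_of_ereal (f (x + t *\<^sub>R h)) - real_of_ereal (f x)) / t)
            \<longlongrightarrow> blinfun_apply g h) (at 0))"

definition grad :: "('a::real_normed_vector \<Rightarrow> ereal) \<Rightarrow> 'a \<Rightarrow> ('a \<Rightarrow>\<^sub>L real)" where
  "grad f x = (THE g. has_gateaux_gradient f x g)"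

definition bregman :: "('a::real_normed_vector \<Rightarrow> ereal) \<Rightarrow> 'a \<Rightarrow> 'a \<Rightarrow> ereal" where
  "bregman f y x =
     (if x \<in> interior (eff_dom f)
      then f y - f x - ereal (blinfun_apply (grad f x) (y - x)) else \<infinity>)"

definition bregman_env ::
  "('a::real_normed_vector \<Rightarrow> ereal) \<Rightarrow> ('a \<Rightarrow> ereal) \<Rightarrow> 'a \<Rightarrow> ereal" where
  "bregman_env \<phi> f x = (INF y. \<phi> y + bregman f y x)"

definition is_minimizer :: "('a \<Rightarrow> ereal) \<Rightarrow> 'a \<Rightarrow> bool" where
  "is_minimizer h y \<longleftrightarrow> (\<forall>z. h y \<le> h z)"

text \<open>
  The two proximity operators are meaningful only where the minimizer exists and is unique.
\<close>

definition bprox ::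
  "('a::real_normed_vector \<Rightarrow> ereal) \<Rightarrow> ('a \<Rightarrow> ereal) \<Rightarrow> 'a \<Rightarrow> 'a" where
  "bprox f \<phi> x = (THE y. is_minimizer (\<lambda>y. \<phi> y + bregman f y x) y)"

definition aprox ::
  "('a::real_normed_vector \<Rightarrow> ereal) \<Rightarrow> ('a \<Rightarrow> ereal) \<Rightarrow> 'a \<Rightarrow> 'a" where
  "aprox f \<phi> x = (THE y. is_minimizer (\<lambda>y. \<phi> y + f (x - y)) y)"

end

theory Submission
  imports Defs
begin

text \<open>
  With \<open>u = grad f x\<close>, the Fenchel--Young equality at \<open>(x, u)\<close> turns the Bregman envelope of the
  conjugates at \<open>u\<close> into \<open>f x - k x\<close>, where \<open>k\<close> is the conjugate of \<open>f\<^sup>* + \<phi>\<^sup>*\<close> read on \<open>'a\<close>. The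
  condition on the strong relative interior makes the infimal convolution of \<open>\<phi>\<close> and \<open>f\<close> equal
  to \<open>k\<close> and exact at \<open>x\<close> (Attouch--Brezis), say at \<open>y = x - z\<close>. As \<open>k\<close> is closed, convex and
  finite around \<open>x\<close>, it has a subgradient \<open>p\<close> there, which is then a common subgradient of \<open>\<phi>\<close>
  at \<open>y\<close> and of \<open>f\<close> at \<open>z\<close>. Since \<open>f\<close> is Legendre, \<open>p\<close> determines \<open>z\<close> and conversely, so \<open>y\<close> and
  \<open>p\<close> are the unique minimizers of the primal and of the dual problem. The gradients exist
  because a subdifferential that is locally bounded at a point of its domain forces that point
  into the interior of the domain of the function.
\<close>

section \<open>Hahn--Banach separation\<close>

text \<open>That \<open>conjugate f\<close> is Legendre and that the gradients are mutually inverse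
  bijections is never established globally: differentiability is derived only at pairs of a point
  and a subgradient of \<open>f\<close> there, and the two pairs \<open>(x, u)\<close> and
  \<open>(z, p)\<close> suffice. The obstacle to exactness is that the condition on the strong
  relative interior gives openness only relative to a closed subspace. The value function on the
  dual may be infinite arbitrarily close to 0, and its epigraph may have empty interior. Every
  separation therefore uses the cone \<open>r < - L * norm v\<close>, which is itself open: a
  Lipschitz lower bound at one point is enough, and the functional obtained is never vertical.
  Functions are handled through their epigraphs, which replaces extended real arithmetic by real
  inequalities. The subgradient at \<open>x\<close> is taken of \<open>k\<close> and not of the
  infimal convolution, since \<open>k\<close> is closed and convex by construction and lies below
  every sum \<open>f w + \<phi> (x - w)\<close>; exactness is then required at \<open>x\<close>
  alone.\<close>

lemma sublinear_dominates_linear: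
  fixes p :: "'a::real_vector \<Rightarrow> real"
  assumes add: "\<And>x y. p (x + y) \<le> p x + p y"
    and scale: "\<And>c x. c \<ge> 0 \<Longrightarrow> p (c *\<^sub>R x) = c * p x"
  obtains l where "linear l" "\<And>x. l x \<le> p x"
proof -
  define sub where "sub q \<longleftrightarrow> (\<forall>x y. q (x + y) \<le> q x + q y) \<and>
      (\<forall>c x. c \<ge> 0 \<longrightarrow> q (c *\<^sub>R x) = c * q x)" for q :: "'a \<Rightarrow> real"
  \<comment> \<open>The order is reversed: \<open>P q r\<close> says that \<open>r\<close> lies
    below \<open>q\<close>, so the maximal element supplied by Zorn's lemma is a minimal sublinear
    function under \<open>p\<close>.\<close>
  define P where "P q r \<longleftrightarrow> (\<forall>x. r x \<le> q x)" for q r :: "'a \<Rightarrow> real"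
  define Q where "Q = {q. sub q \<and> P p q}"
  have sub_add: "q (x + y) \<le> q x + q y" and sub_scale: "c \<ge> 0 \<Longrightarrow> q (c *\<^sub>R x) = c * q x"
    if "sub q" for q x y c
    using that by (auto simp: sub_def)
  have sub0: "q 0 = 0" if "sub q" for q
    using sub_scale[OF that, of 0 0] by simp
  have lower: "- q (- x) \<le> q x" if "sub q" for q x
    using sub_add[OF that, of x "- x"] sub0[OF that] by simp
  have P_refl: "P q q" for q
    by (simp add: P_def)
  have "partial_order_on Q (relation_of P Q)"
    by (rule partial_order_on_relation_ofI) (auto simp: P_def intro!: ext intro: order_trans antisym)
  then have "\<exists>m\<in>Q. \<forall>a\<in>Q. P m a \<longrightarrow> a = m"
  proof (rule predicate_Zorn)
    fix C assume "C \<in> Chains (relation_of P Q)"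
    then have C: "C \<subseteq> Q" and tot: "\<And>q r. q \<in> C \<Longrightarrow> r \<in> C \<Longrightarrow> P q r \<or> P r q"
      by (auto simp: Chains_def relation_of_def)
    show "\<exists>u\<in>Q. \<forall>a\<in>C. P a u"
    proof (cases "C = {}")
      case True
      have "p \<in> Q" using add scale by (auto simp: Q_def sub_def P_refl)
      then show ?thesis using True by blast
    next
      case False
      \<comment> \<open>The bound of a chain is its pointwise infimum, finite because every
        sublinear \<open>q\<close> below \<open>p\<close> satisfies
        \<open>- p (- x) \<le> q x\<close>.\<close>
      define u where "u x = (INF q\<in>C. q x)" for x
      have bound: "- p (- x) \<le> q x" if "q \<in> C" for q x
      proof -
        have "q (- x) \<le> p (- x)" "sub q" using that C by (auto simp: Q_def P_def)
        then show ?thesis using lower[of q x] by simp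
      qed
      have bdd: "bdd_below ((\<lambda>q. q x) ` C)" for x
        using bound by (auto intro!: bdd_belowI[of _ "- p (- x)"])
      have u_le: "u x \<le> q x" if "q \<in> C" for q x
        unfolding u_def by (rule cINF_lower[OF bdd that])
      have le_u: "c \<le> u x" if "\<And>q. q \<in> C \<Longrightarrow> c \<le> q x" for c x
        unfolding u_def by (rule cINF_greatest[OF False that])
      have u_add: "u (x + y) \<le> u x + u y" for x y
      proof -
        \<comment> \<open>Subadditivity of the infimum needs comparability: the smaller of
          \<open>q1\<close> and \<open>q2\<close> can be used at both points.\<close>
        have *: "u (x + y) \<le> q1 x + q2 y" if q: "q1 \<in> C" "q2 \<in> C" for q1 q2
        proof -
          have s: "sub q1" "sub q2" using q C by (auto simp: Q_def)
          consider "P q1 q2" | "P q2 q1" using tot[OF q] by blast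
          then show ?thesis
          proof cases
            case 1
            then show ?thesis
              using u_le[OF q(2), of "x + y"] sub_add[OF s(2), of x y]
              by (simp add: P_def) (meson add_left_mono add_right_mono order_trans)
          next
            case 2
            then show ?thesis
              using u_le[OF q(1), of "x + y"] sub_add[OF s(1), of x y]
              by (simp add: P_def) (meson add_left_mono add_right_mono order_trans)
          qed
        qed
        have "u (x + y) - q1 x \<le> u y" if "q1 \<in> C" for q1
        proof (rule le_u)
          show "u (x + y) - q1 x \<le> q y" if "q \<in> C" for q
            using *[OF \<open>q1 \<in> C\<close> that] by simp
        qed
        then have "u (x + y) - u y \<le> u x"
          by (intro le_u) (simp add: algebra_simps)
        then show ?thesis by simp
      qed
      have u_scale: "u (c *\<^sub>R x) = c * u x" if c: "c \<ge> 0" for c x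
      proof (cases "c = 0")
        case True
        have "q 0 = 0" if "q \<in> C" for q
          using that C sub0 by (auto simp: Q_def)
        then have "u 0 = (INF q\<in>C. 0)"
          unfolding u_def by (intro INF_cong) auto
        then show ?thesis using True False by simp
      next
        case c0: False
        have eq: "q (c *\<^sub>R x) = c * q x" if "q \<in> C" for q
          using that C c by (auto simp: Q_def sub_scale)
        have "u (c *\<^sub>R x) / c \<le> u x"
          by (rule le_u) (use u_le[of _ "c *\<^sub>R x"] c c0 eq in \<open>simp add: field_simps\<close>)
        moreover have "c * u x \<le> u (c *\<^sub>R x)"
        proof (rule le_u)
          fix q assume q: "q \<in> C"
          show "c * u x \<le> q (c *\<^sub>R x)"
            unfolding eq[OF q] by (rule mult_left_mono[OF u_le[OF q] c])
        qed
        ultimately show ?thesis using c c0 by (simp add: field_simps)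
      qed
      obtain q0 where q0: "q0 \<in> C" using False by blast
      then have "q0 x \<le> p x" for x using C by (auto simp: Q_def P_def)
      then have "P p u" unfolding P_def using u_le[OF q0] order_trans by blast
      then have "u \<in> Q" using u_add u_scale by (auto simp: Q_def sub_def)
      then show ?thesis using u_le by (auto simp: P_def)
    qed
  qed
  then obtain m where m: "m \<in> Q" and min: "\<And>a. a \<in> Q \<Longrightarrow> P m a \<Longrightarrow> a = m" by blast
  have subm: "sub m" using m by (simp add: Q_def)
  have odd: "m (- a) \<le> - m a" for a
  proof -
    \<comment> \<open>The largest attempt to lower \<open>m\<close> along \<open>a\<close>: this
      \<open>q\<close> is again sublinear and below \<open>m\<close>, so minimality gives
      \<open>q = m\<close>. The choice \<open>t = 1\<close> at \<open>- a\<close> then yields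
      \<open>m (- a) \<le> - m a\<close>, and an odd sublinear function is linear.\<close>
    define q where "q x = (INF t\<in>{0..}. m (x + t *\<^sub>R a) - t * m a)" for x
    have bound: "- m (- x) \<le> m (x + t *\<^sub>R a) - t * m a" if "t \<ge> 0" for t x
      using sub_add[OF subm, of "x + t *\<^sub>R a" "- x"] sub_scale[OF subm that, of a] by simp
    have bdd: "bdd_below ((\<lambda>t. m (x + t *\<^sub>R a) - t * m a) ` {0..})" for x
      using bound by (auto intro!: bdd_belowI[of _ "- m (- x)"])
    have q_le: "q x \<le> m (x + t *\<^sub>R a) - t * m a" if "t \<ge> 0" for t x
      unfolding q_def by (rule cINF_lower[OF bdd]) (use that in simp)
    have le_q: "c \<le> q x" if "\<And>t. t \<ge> 0 \<Longrightarrow> c \<le> m (x + t *\<^sub>R a) - t * m a" for c x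
      unfolding q_def by (rule cINF_greatest) (use that in auto)
    have q_m: "q x \<le> m x" for x using q_le[of 0 x] by simp
    have q_add: "q (x + y) \<le> q x + q y" for x y
    proof -
      have *: "q (x + y) \<le> (m (x + s *\<^sub>R a) - s * m a) + (m (y + t *\<^sub>R a) - t * m a)"
        if "s \<ge> 0" "t \<ge> 0" for s t
      proof -
        have "(x + y) + (s + t) *\<^sub>R a = (x + s *\<^sub>R a) + (y + t *\<^sub>R a)"
          by (simp add: algebra_simps)
        then show ?thesis
          using q_le[of "s + t" "x + y"] sub_add[OF subm, of "x + s *\<^sub>R a" "y + t *\<^sub>R a"] that
          by (simp add: algebra_simps)
      qed
      have "q (x + y) - (m (x + s *\<^sub>R a) - s * m a) \<le> q y" if "s \<ge> 0" for s
        by (rule le_q) (use *[OF that] in \<open>simp add: algebra_simps\<close>)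
      then have "q (x + y) - q y \<le> q x"
        by (intro le_q) (simp add: algebra_simps)
      then show ?thesis by simp
    qed
    have q_scale: "q (c *\<^sub>R x) = c * q x" if c: "c \<ge> 0" for c x
    proof (cases "c = 0")
      case True
      have "0 \<le> q 0" by (rule le_q) (simp add: sub_scale[OF subm])
      moreover have "q 0 \<le> 0" using q_m[of 0] sub0[OF subm] by simp
      ultimately show ?thesis using True by simp
    next
      case False
      then have c: "c > 0" using c by simp
      have eq: "m (c *\<^sub>R x + (c * t) *\<^sub>R a) = c * m (x + t *\<^sub>R a)" if "t \<ge> 0" for t
        using sub_scale[OF subm, of c "x + t *\<^sub>R a"] c by (simp add: algebra_simps)
      have "q (c *\<^sub>R x) / c \<le> q x"
      proof (rule le_q)
        fix t :: real assume t: "t \<ge> 0"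
        show "q (c *\<^sub>R x) / c \<le> m (x + t *\<^sub>R a) - t * m a"
          using q_le[of "c * t" "c *\<^sub>R x"] t c eq[OF t] by (simp add: field_simps)
      qed
      moreover have "c * q x \<le> q (c *\<^sub>R x)"
      proof (rule le_q)
        fix t :: real assume t: "t \<ge> 0"
        have "q x \<le> m (x + (t / c) *\<^sub>R a) - t / c * m a" using q_le[of "t / c" x] t c by simp
        then have "c * q x \<le> c * (m (x + (t / c) *\<^sub>R a) - t / c * m a)"
          using c by simp
        then show "c * q x \<le> m (c *\<^sub>R x + t *\<^sub>R a) - t * m a"
          using eq[of "t / c"] t c by (simp add: right_diff_distrib)
      qed
      ultimately show ?thesis using c by (simp add: field_simps)
    qed
    have "m x \<le> p x" for x using m by (simp add: Q_def P_def)
    then have "P p q" unfolding P_def using q_m order_trans by blast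
    then have "q \<in> Q" using q_add q_scale by (simp add: Q_def sub_def)
    then have "q = m" using min q_m by (simp add: P_def)
    then show ?thesis using q_le[of 1 "- a"] sub0[OF subm] by simp
  qed
  have neg: "m (- x) = - m x" for x
    using odd[of x] lower[OF subm, of "- x"] by simp
  have "linear m"
  proof (rule linearI)
    show "m (x + y) = m x + m y" for x y
      using sub_add[OF subm, of x y] sub_add[OF subm, of "- x" "- y"] neg[of x] neg[of y] neg[of "x + y"]
      by simp
    show "m (c *\<^sub>R x) = c *\<^sub>R m x" for c x
    proof (cases "c \<ge> 0")
      case True then show ?thesis by (simp add: sub_scale[OF subm])
    next
      case False
      then show ?thesis using sub_scale[OF subm, of "- c" x] neg[of "c *\<^sub>R x"] by simp
    qed
  qed
  moreover have "m x \<le> p x" for x using m by (simp add: Q_def P_def)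
  ultimately show thesis using that by blast
qed

text \<open>The open cone \<open>r < - L * norm v\<close> is separated from \<open>C\<close>.\<close>

lemma convex_above_cone_separation:
  fixes C :: "('a::real_normed_vector \<times> real) set"
  assumes C: "convex C" "C \<noteq> {}" and L: "\<And>v r. (v, r) \<in> C \<Longrightarrow> - L * norm v \<le> r"
    and L0: "L \<ge> 0"
  obtains \<xi> :: "'a \<Rightarrow>\<^sub>L real" where "norm \<xi> \<le> L" "\<And>v r. (v, r) \<in> C \<Longrightarrow> blinfun_apply \<xi> v \<le> r"
proof -
  \<comment> \<open>The convex cone generated by \<open>C\<close>. The lower bound by
    \<open>- L * norm v\<close> is positively homogeneous, so it passes from \<open>C\<close> to
    \<open>K\<close>.\<close>
  define K where "K = {(s *\<^sub>R v, s * r) | s v r. s \<ge> 0 \<and> (v, r) \<in> C}"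
  obtain v0 r0 where "(v0, r0) \<in> C" using C(2) by (cases) auto
  then have K0: "(0, 0) \<in> K" unfolding K_def by force
  have CK: "k \<in> K" if "k \<in> C" for k
    using that unfolding K_def by (cases k) (force intro: exI[of _ 1])
  have KL: "- L * norm v \<le> r" if vr: "(v, r) \<in> K" for v r
  proof -
    obtain s w t where s: "v = s *\<^sub>R w" "r = s * t" "s \<ge> 0" "(w, t) \<in> C" using vr by (auto simp: K_def)
    have "s * (- L * norm w) \<le> s * t" by (rule mult_left_mono[OF L[OF s(4)] s(3)])
    then show ?thesis using s by (simp add: algebra_simps)
  qed
  have K_scale: "(c *\<^sub>R v, c * r) \<in> K" if vr: "(v, r) \<in> K" and c: "c \<ge> 0" for c v r
  proof -
    obtain s w t where "v = s *\<^sub>R w" "r = s * t" "s \<ge> 0" "(w, t) \<in> C" using vr by (auto simp: K_def)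
    then show ?thesis using c unfolding K_def
      by (intro CollectI exI[of _ "c * s"] exI[of _ w] exI[of _ t]) simp
  qed
  have K_add: "(v1 + v2, r1 + r2) \<in> K" if K12: "(v1, r1) \<in> K" "(v2, r2) \<in> K" for v1 v2 r1 r2
  proof -
    obtain s1 w1 t1 where 1: "v1 = s1 *\<^sub>R w1" "r1 = s1 * t1" "s1 \<ge> 0" "(w1, t1) \<in> C"
      using K12(1) by (auto simp: K_def)
    obtain s2 w2 t2 where 2: "v2 = s2 *\<^sub>R w2" "r2 = s2 * t2" "s2 \<ge> 0" "(w2, t2) \<in> C"
      using K12(2) by (auto simp: K_def)
    show ?thesis
    proof (cases "s1 + s2 = 0")
      case True
      then have "s1 = 0" "s2 = 0" using 1 2 by auto
      then show ?thesis using 1 2 K0 by simp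
    next
      case False
      then have pos: "s1 + s2 > 0" using 1 2 by simp
      define a b where "a = s1 / (s1 + s2)" and "b = s2 / (s1 + s2)"
      have ab: "a \<ge> 0" "b \<ge> 0" "a + b = 1" "(s1 + s2) * a = s1" "(s1 + s2) * b = s2"
        using 1 2 pos by (auto simp: a_def b_def add_divide_distrib[symmetric])
      have "a *\<^sub>R (w1, t1) + b *\<^sub>R (w2, t2) \<in> C"
        by (rule convexD[OF C(1) 1(4) 2(4) ab(1-3)])
      then have "((s1 + s2) *\<^sub>R (a *\<^sub>R w1 + b *\<^sub>R w2), (s1 + s2) * (a * t1 + b * t2)) \<in> K"
        using pos unfolding K_def by force
      moreover have "(s1 + s2) *\<^sub>R (a *\<^sub>R w1 + b *\<^sub>R w2) = v1 + v2"
        unfolding scaleR_add_right scaleR_scaleR ab 1 2 ..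
      moreover have "(s1 + s2) * (a * t1 + b * t2) = r1 + r2"
        unfolding distrib_left mult.assoc[symmetric] ab 1 2 ..
      ultimately show ?thesis by simp
    qed
  qed
  \<comment> \<open>The choice \<open>(0, 0)\<close> in \<open>K\<close> gives
    \<open>p w \<le> L * norm w\<close>, and \<open>w = v\<close> gives \<open>p v \<le> r\<close>
    on \<open>K\<close>. A linear function below \<open>p\<close> thus has norm at most
    \<open>L\<close> and lies below \<open>C\<close> at once; the bound on \<open>K\<close> keeps
    the infimum finite.\<close>
  define p where "p w = (INF (v, r)\<in>K. r + L * norm (w - v))" for w
  have lower: "- L * norm w \<le> r + L * norm (w - v)" if "(v, r) \<in> K" for v r w
  proof -
    have "L * norm v \<le> L * (norm w + norm (w - v))"
      using norm_triangle_ineq4[of w "w - v"] L0 by (simp add: mult_left_mono)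
    then show ?thesis using KL[OF that] by (simp add: algebra_simps)
  qed
  have bdd: "bdd_below ((\<lambda>(v, r). r + L * norm (w - v)) ` K)" for w
    using lower[of _ _ w] by (auto intro!: bdd_belowI[of _ "- L * norm w"])
  have p_le: "p w \<le> r + L * norm (w - v)" if "(v, r) \<in> K" for v r w
    unfolding p_def using cINF_lower[OF bdd that, of w] by simp
  have le_p: "c \<le> p w" if "\<And>v r. (v, r) \<in> K \<Longrightarrow> c \<le> r + L * norm (w - v)" for c w
    unfolding p_def by (rule cINF_greatest) (use that K0 in auto)
  have p_add: "p (x + y) \<le> p x + p y" for x y
  proof -
    have *: "p (x + y) \<le> (r1 + L * norm (x - v1)) + (r2 + L * norm (y - v2))"
      if k: "(v1, r1) \<in> K" "(v2, r2) \<in> K" for v1 r1 v2 r2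
    proof -
      have "L * norm (x + y - (v1 + v2)) \<le> L * (norm (x - v1) + norm (y - v2))"
        using norm_triangle_ineq[of "x - v1" "y - v2"] L0
        by (intro mult_left_mono) (simp_all add: algebra_simps)
      then show ?thesis using p_le[OF K_add[OF k], of "x + y"] by (simp add: algebra_simps)
    qed
    have "p (x + y) - (r1 + L * norm (x - v1)) \<le> p y" if "(v1, r1) \<in> K" for v1 r1
      by (rule le_p) (use *[OF that] in \<open>simp add: algebra_simps\<close>)
    then have "p (x + y) - p y \<le> p x"
      by (intro le_p) (simp add: algebra_simps)
    then show ?thesis by simp
  qed
  have p_up: "p w \<le> L * norm w" for w using p_le[OF K0, of w] by simp
  have p_low: "- L * norm w \<le> p w" for w by (rule le_p) (rule lower)
  have p_scale: "p (c *\<^sub>R x) = c * p x" if c: "c \<ge> 0" for c x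
  proof (cases "c = 0")
    case True
    then show ?thesis using p_up[of 0] p_low[of 0] by simp
  next
    case False
    then have c: "c > 0" using c by simp
    have le: "p (d *\<^sub>R y) \<le> d * p y" if d: "d > 0" for d y
    proof -
      have "p (d *\<^sub>R y) / d \<le> p y"
      proof (rule le_p)
        fix v r assume "(v, r) \<in> K"
        then have "p (d *\<^sub>R y) \<le> d * r + L * norm (d *\<^sub>R y - d *\<^sub>R v)"
          using d by (intro p_le K_scale) auto
        then have "p (d *\<^sub>R y) \<le> d * r + L * (d * norm (y - v))"
          using d by (simp add: scaleR_diff_right[symmetric])
        then show "p (d *\<^sub>R y) / d \<le> r + L * norm (y - v)" using d by (simp add: field_simps)
      qed
      then show ?thesis using d by (simp add: field_simps)
    qed
    have "p x \<le> (1 / c) * p (c *\<^sub>R x)" using le[of "1 / c" "c *\<^sub>R x"] c by simp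
    then show ?thesis using le[OF c, of x] c by (simp add: field_simps)
  qed
  obtain l where l: "linear l" "\<And>x. l x \<le> p x"
    using sublinear_dominates_linear[of p, OF p_add p_scale] by metis
  have abs: "\<bar>l x\<bar> \<le> L * norm x" for x
    using l(2)[of x] l(2)[of "- x"] p_up[of x] p_up[of "- x"] linear_neg[OF l(1), of x] by simp
  have bl: "bounded_linear l"
    by (rule bounded_linear_intro[of _ L])
      (use l(1) abs in \<open>auto simp: linear_add linear_cmul mult.commute\<close>)
  show thesis
  proof
    show "norm (Blinfun l) \<le> L"
      by (rule norm_blinfun_bound[OF L0]) (use abs bl in \<open>simp add: bounded_linear_Blinfun_apply\<close>)
    show "blinfun_apply (Blinfun l) v \<le> r" if "(v, r) \<in> C" for v r
      using l(2)[of v] p_le[OF CK[OF that], of v] bl by (simp add: bounded_linear_Blinfun_apply)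
  qed
qed

section \<open>Projections of closed convex sets and Ekeland's principle\<close>

text \<open>The halving argument of the open mapping theorem, run inside the convex set \<open>D\<close>.\<close>

lemma convex_closed_projection_closure_ball:
  fixes D :: "('e::banach \<times> 'v::real_normed_vector) set"
  assumes D: "convex D" "closed D" "bounded (fst ` D)" and S: "subspace S" "snd ` D \<subseteq> S"
    and \<rho>: "\<rho> > 0" "ball 0 \<rho> \<inter> S \<subseteq> closure (snd ` D)"
  shows "ball 0 (\<rho> / 2) \<inter> S \<subseteq> snd ` D"
proof
  fix w assume "w \<in> ball 0 (\<rho> / 2) \<inter> S"
  then have w: "norm w < \<rho> / 2" "w \<in> S" by auto
  have "\<exists>d\<in>D. norm (y - snd d) < \<rho> / 2" if y: "y \<in> ball 0 \<rho> \<inter> S" for y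
  proof -
    have "y \<in> closure (snd ` D)" using y \<rho>(2) by blast
    then obtain u where "u \<in> snd ` D" "dist u y < \<rho> / 2"
      using \<rho>(1) unfolding closure_approachable by (meson half_gt_zero)
    then show ?thesis by (force simp: dist_norm norm_minus_commute)
  qed
  then obtain pick where pick: "\<And>y. y \<in> ball 0 \<rho> \<inter> S \<Longrightarrow> pick y \<in> D"
      "\<And>y. y \<in> ball 0 \<rho> \<inter> S \<Longrightarrow> norm (y - snd (pick y)) < \<rho> / 2"
    by metis
  \<comment> \<open>The rescaled remainders: after subtracting an approximant with error below
    \<open>\<rho> / 2\<close>, doubling the error leads back into the ball. Unrolled,
    \<open>w\<close> becomes the sum of the \<open>snd (d i)\<close> with weights
    \<open>(1/2)^Suc i\<close>.\<close>
  define y where "y = rec_nat (2 *\<^sub>R w) (\<lambda>_ u. 2 *\<^sub>R (u - snd (pick u)))"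
  have y0: "y 0 = 2 *\<^sub>R w" and ySuc: "y (Suc n) = 2 *\<^sub>R (y n - snd (pick (y n)))" for n
    by (simp_all add: y_def)
  have y: "y n \<in> ball 0 \<rho> \<inter> S" for n
  proof (induction n)
    case 0
    then show ?case using w S(1) by (auto simp: y0 subspace_scale)
  next
    case (Suc n)
    have "snd (pick (y n)) \<in> S" using pick(1)[OF Suc] S(2) by auto
    then have "y (Suc n) \<in> S"
      unfolding ySuc using Suc S(1) by (auto intro!: subspace_scale subspace_diff)
    moreover have "norm (y (Suc n)) < \<rho>" unfolding ySuc using pick(2)[OF Suc] by simp
    ultimately show ?case by simp
  qed
  define d where "d n = pick (y n)" for n
  have dD: "d n \<in> D" for n using pick(1)[OF y] by (simp add: d_def)
  define s where "s n = (\<Sum>i<n. (1/2)^Suc i *\<^sub>R d i)" for n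
  \<comment> \<open>The first \<open>n\<close> weights sum to \<open>1 - (1/2)^n\<close>; giving the
    missing weight to any point \<open>e\<close> of \<open>D\<close> makes a genuine convex
    combination, and this padding vanishes in the limit.\<close>
  have sD: "s n + (1/2)^n *\<^sub>R e \<in> D" if "e \<in> D" for e n
    using that
  proof (induction n arbitrary: e)
    case 0
    then show ?case by (simp add: s_def)
  next
    case (Suc n)
    have "(1/2) *\<^sub>R d n + (1/2) *\<^sub>R e \<in> D" using convexD[OF D(1) dD Suc.prems] by simp
    from Suc.IH[OF this] show ?case by (simp add: s_def scaleR_add_right add.assoc)
  qed
  obtain e where e: "e \<in> D" using dD by blast
  obtain M where M: "\<And>u. u \<in> D \<Longrightarrow> norm (fst u) \<le> M"
    using D(3) by (auto simp: bounded_iff)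
  have half: "(\<lambda>n. (1/2::real)^n) \<longlonglongrightarrow> 0" by (rule LIMSEQ_power_zero) simp
  \<comment> \<open>Boundedness of the first projection and completeness of the first factor give a
    limit of the first coordinates; the second coordinates tend to \<open>w\<close> by
    construction.\<close>
  have "summable (\<lambda>i. (1/2)^Suc i *\<^sub>R fst (d i))"
  proof (rule summable_comparison_test'[where N = 0])
    show "summable (\<lambda>i. (1/2::real)^Suc i * M)"
      by (intro summable_mult2 summable_Suc_iff[THEN iffD2]) simp
    show "norm ((1/2)^Suc i *\<^sub>R fst (d i)) \<le> (1/2)^Suc i * M" for i
      using M[OF dD, of i] by (simp add: mult_left_mono)
  qed
  then obtain q where q: "(\<lambda>n. \<Sum>i<n. (1/2)^Suc i *\<^sub>R fst (d i)) \<longlonglongrightarrow> q"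
    by (auto simp: summable_def sums_def)
  have fst_s: "fst (s n) = (\<Sum>i<n. (1/2)^Suc i *\<^sub>R fst (d i))" for n
    by (simp add: s_def fst_sum)
  have snd_s: "snd (s n) = w - (1/2)^Suc n *\<^sub>R y n" for n
  proof (induction n)
    case 0
    then show ?case by (simp add: s_def y0)
  next
    case (Suc n)
    have "s (Suc n) = s n + (1/2)^Suc n *\<^sub>R d n" by (simp add: s_def)
    then have "snd (s (Suc n)) = w - (1/2)^Suc n *\<^sub>R y n + (1/2)^Suc n *\<^sub>R snd (d n)"
      using Suc by simp
    also have "\<dots> = w - (1/2)^Suc (Suc n) *\<^sub>R y (Suc n)"
      by (simp add: ySuc d_def algebra_simps)
    finally show ?case .
  qed
  have y_lim: "(\<lambda>n. (1/2)^Suc n *\<^sub>R y n) \<longlonglongrightarrow> 0"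
  proof (rule tendsto_norm_zero_cancel, rule tendsto_sandwich[of "\<lambda>_. 0" _ _ "\<lambda>n. (1/2)^n * \<rho>"])
    show "\<forall>\<^sub>F n in sequentially. norm ((1/2)^Suc n *\<^sub>R y n) \<le> (1/2)^n * \<rho>"
    proof (rule always_eventually, rule allI)
      fix n
      have "norm ((1/2)^Suc n *\<^sub>R y n) = (1/2)^n * (norm (y n) / 2)" by simp
      also have "\<dots> \<le> (1/2)^n * \<rho>"
        using y[of n] \<rho>(1) by (intro mult_left_mono) auto
      finally show "norm ((1/2)^Suc n *\<^sub>R y n) \<le> (1/2)^n * \<rho>" .
    qed
    show "(\<lambda>n. (1/2)^n * \<rho>) \<longlonglongrightarrow> 0" using tendsto_mult_right[OF half, of \<rho>] by simp
  qed auto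
  have "s \<longlonglongrightarrow> (q, w)"
  proof -
    have "(\<lambda>n. snd (s n)) \<longlonglongrightarrow> w"
      unfolding snd_s using tendsto_diff[OF tendsto_const y_lim, of w] by simp
    moreover have "(\<lambda>n. fst (s n)) \<longlonglongrightarrow> q" unfolding fst_s by (rule q)
    ultimately have "(\<lambda>n. (fst (s n), snd (s n))) \<longlonglongrightarrow> (q, w)" by (intro tendsto_Pair)
    then show ?thesis by simp
  qed
  moreover have "(\<lambda>n. (1/2)^n *\<^sub>R e) \<longlonglongrightarrow> 0"
    using tendsto_scaleR[OF half tendsto_const, of e] by simp
  ultimately have "(\<lambda>n. s n + (1/2)^n *\<^sub>R e) \<longlonglongrightarrow> (q, w)"
    using tendsto_add by fastforce
  then have "(q, w) \<in> D"
    by (rule closed_sequentially[OF D(2) sD[OF e]])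
  then show "w \<in> snd ` D" by force
qed

text \<open>Baire's theorem in the complete space \<open>S\<close> gives one dilated closure of a
  projection relative interior. Absorption in the direction opposite to its centre moves the ball to
  the origin by convexity, and the halving argument then removes the closure at the price of half
  the radius.\<close>

lemma convex_closed_projection_absorbing:
  fixes D :: "nat \<Rightarrow> ('e::banach \<times> 'v::banach) set"
  assumes D: "\<And>n. convex (D n)" "\<And>n. closed (D n)" "\<And>n. bounded (fst ` D n)"
    and mono: "\<And>m n. m \<le> n \<Longrightarrow> D m \<subseteq> D n"
    and S: "subspace S" "closed S" "\<And>n. snd ` D n \<subseteq> S"
    and absorb: "\<And>w. w \<in> S \<Longrightarrow> \<exists>n. \<exists>t>0. t *\<^sub>R w \<in> snd ` D n"
  obtains n \<rho> where "\<rho> > 0" "ball 0 \<rho> \<inter> S \<subseteq> snd ` D n"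
proof -
  define A where "A n = snd ` D n" for n
  have A_conv: "convex (A n)" for n
    unfolding A_def by (rule convex_linear_image[OF linear_snd D(1)])
  have A_mono: "A m \<subseteq> A n" if "m \<le> n" for m n using mono[OF that] by (auto simp: A_def)
  define T where "T n = {w \<in> S. (1 / real (Suc n)) *\<^sub>R w \<in> closure (A n)}" for n
  have S0: "0 \<in> S" using S(1) by (rule subspace_0)
  obtain n0 where n0: "0 \<in> A n0" using absorb[OF S0] by (auto simp: A_def)
  have cover: "\<exists>n. w \<in> T n" if w: "w \<in> S" for w
  proof -
    obtain m t where mt: "t > 0" "t *\<^sub>R w \<in> A m" using absorb[OF w] by (auto simp: A_def)
    obtain k :: nat where k: "1 / t < real k" using reals_Archimedean2 by blast
    \<comment> \<open>Large enough that \<open>1 / real (Suc n) \<le> t\<close>, so the scaled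
      \<open>w\<close> lies between \<open>0\<close> and \<open>t *\<^sub>R w\<close>, both of which
      belong to \<open>A n\<close>.\<close>
    define n where "n = max (max m n0) k"
    define c where "c = 1 / (real (Suc n) * t)"
    have "1 / t \<le> real (Suc n)" using k by (simp add: n_def)
    then have c: "0 \<le> c" "c \<le> 1" using mt(1) by (simp_all add: c_def field_simps)
    have "c *\<^sub>R t *\<^sub>R w + (1 - c) *\<^sub>R 0 \<in> A n"
    proof (rule convexD[OF A_conv])
      show "t *\<^sub>R w \<in> A n" using mt(2) A_mono[of m n] by (auto simp: n_def max_def)
      show "0 \<in> A n" using n0 A_mono[of n0 n] by (auto simp: n_def max_def)
    qed (use c in auto)
    then have "(1 / real (Suc n)) *\<^sub>R w \<in> A n" using mt(1) by (simp add: c_def)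
    then show ?thesis using w closure_subset by (auto simp: T_def)
  qed
  have T_closed: "closedin (top_of_set S) (T n)" for n
  proof -
    have "closed ((\<lambda>w. (1 / real (Suc n)) *\<^sub>R w) -` closure (A n))"
      by (intro closed_vimage) (auto intro!: continuous_intros)
    then have "closedin (top_of_set S) (S \<inter> ((\<lambda>w. (1 / real (Suc n)) *\<^sub>R w) -` closure (A n)))"
      by (auto simp: closedin_closed)
    moreover have "T n = S \<inter> ((\<lambda>w. (1 / real (Suc n)) *\<^sub>R w) -` closure (A n))"
      by (auto simp: T_def)
    ultimately show ?thesis by simp
  qed
  have "\<exists>n. top_of_set S interior_of T n \<noteq> {}"
  proof (rule ccontr)
    assume "\<not> ?thesis"
    then have "top_of_set S interior_of \<Union>(range T) = {}"
      using S(2) T_closed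
      by (intro Baire_category_alt)
        (auto simp: completely_metrizable_space_closedin completely_metrizable_space_euclidean)
    moreover have "\<Union>(range T) = S" using cover by (auto simp: T_def)
    ultimately show False
      using S0 by (metis empty_iff interior_of_topspace topspace_euclidean_subtopology)
  qed
  then obtain n a where "a \<in> top_of_set S interior_of T n" by blast
  then obtain U where U: "open U" "a \<in> U" "a \<in> S" "U \<inter> S \<subseteq> T n"
    by (auto simp: interior_of_def openin_open)
  obtain r where r: "r > 0" "ball a r \<subseteq> U" using U(1,2) by (auto simp: open_contains_ball)
  obtain m t where mt: "t > 0" "t *\<^sub>R (- a) \<in> A m"
    using absorb[OF subspace_neg[OF S(1) U(3)]] by (auto simp: A_def)
  define N where "N = max m n"
  \<comment> \<open>The normalizer of the weights \<open>t * real (Suc n)\<close> and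
    \<open>1\<close>, chosen so that the contributions of the centre \<open>a\<close> cancel and
    only \<open>(t / k) *\<^sub>R u\<close> remains.\<close>
  define k where "k = 1 + t * real (Suc n)"
  have k: "k > 0" using mt(1) by (simp add: k_def add_pos_nonneg)
  have "ball 0 (t / k * r) \<inter> S \<subseteq> closure (A N)"
  proof
    fix v assume v: "v \<in> ball 0 (t / k * r) \<inter> S"
    define u where "u = (k / t) *\<^sub>R v"
    have "norm u < r" using v k mt(1) by (simp add: u_def field_simps)
    moreover have "u \<in> S" using v S(1) by (simp add: u_def subspace_scale)
    ultimately have "a + u \<in> ball a r" "a + u \<in> S"
      using U(3) S(1) by (auto simp: dist_norm subspace_add)
    then have "a + u \<in> T n" using r(2) U(4) by blast
    then have "(1 / real (Suc n)) *\<^sub>R (a + u) \<in> closure (A N)"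
      using closure_mono[OF A_mono[of n N]] by (auto simp: T_def N_def)
    moreover have "t *\<^sub>R (- a) \<in> closure (A N)"
      using mt A_mono[of m N] closure_subset by (fastforce simp: N_def)
    moreover have "t * real (Suc n) / k + 1 / k = 1" using k by (simp add: k_def field_simps)
    ultimately have "(t * real (Suc n) / k) *\<^sub>R (1 / real (Suc n)) *\<^sub>R (a + u) + (1 / k) *\<^sub>R t *\<^sub>R (- a)
        \<in> closure (A N)"
      using k mt(1) by (intro convexD[OF convex_closure[OF A_conv]]) auto
    moreover have "(t * real (Suc n) / k) *\<^sub>R (1 / real (Suc n)) *\<^sub>R (a + u) + (1 / k) *\<^sub>R t *\<^sub>R (- a) = v"
    proof -
      have "(t * real (Suc n) / k) * (1 / real (Suc n)) = t / k" by simp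
      then have "(t * real (Suc n) / k) *\<^sub>R (1 / real (Suc n)) *\<^sub>R (a + u) = (t / k) *\<^sub>R (a + u)"
        unfolding scaleR_scaleR by (rule arg_cong)
      then show ?thesis using k mt(1) by (simp add: u_def scaleR_add_right)
    qed
    ultimately show "v \<in> closure (A N)" by simp
  qed
  then have "ball 0 (t / k * r / 2) \<inter> S \<subseteq> snd ` D N"
    using k mt(1) r(1) S D by (intro convex_closed_projection_closure_ball) (auto simp: A_def)
  moreover have "t / k * r / 2 > 0" using k mt(1) r(1) by simp
  ultimately show thesis using that by blast
qed

text \<open>Ekeland's principle for a closed set of points and heights, which plays the role of the
  epigraph of a lower semicontinuous function. The sets \<open>S e\<close> of points reachable from
  \<open>e\<close> at the cost \<open>\<epsilon> * dist\<close> are closed and nested along the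
  iteration; the limit lies in all of them.\<close>

lemma ekeland_epigraph:
  fixes E :: "('a::complete_space \<times> real) set"
  assumes E: "closed E" "\<And>x r. (x, r) \<in> E \<Longrightarrow> m \<le> r" and \<epsilon>: "\<epsilon> > 0" and zE: "(z, c) \<in> E"
  obtains x r where "(x, r) \<in> E" "r + \<epsilon> * dist z x \<le> c"
    "\<And>y s. (y, s) \<in> E \<Longrightarrow> r \<le> s + \<epsilon> * dist x y"
proof -
  define S where "S e = {d \<in> E. snd d + \<epsilon> * dist (fst e) (fst d) \<le> snd e}" for e
  have S_refl: "e \<in> S e" if "e \<in> E" for e using that by (simp add: S_def)
  have S_trans: "b \<in> S e" if "d \<in> S e" "b \<in> S d" for e d b
  proof -
    have "\<epsilon> * dist (fst e) (fst b) \<le> \<epsilon> * (dist (fst e) (fst d) + dist (fst d) (fst b))"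
      using \<epsilon> by (intro mult_left_mono dist_triangle) simp
    then show ?thesis using that by (auto simp: S_def algebra_simps)
  qed
  have S_closed: "closed (S e)" for e
  proof -
    have "S e = E \<inter> {d. snd d + \<epsilon> * dist (fst e) (fst d) \<le> snd e}" by (auto simp: S_def)
    moreover have "closed {d. snd d + \<epsilon> * dist (fst e) (fst d) \<le> snd e}"
      by (intro closed_Collect_le continuous_intros)
    ultimately show ?thesis using E(1) by (simp add: closed_Int)
  qed
  define I where "I e = (INF d\<in>S e. snd d)" for e
  have bdd: "bdd_below (snd ` S e)" for e
    using E(2) by (auto simp: S_def intro!: bdd_belowI[of _ m])
  have I_le: "I e \<le> snd d" if "d \<in> S e" for d e
    unfolding I_def by (rule cINF_lower[OF bdd that])
  \<comment> \<open>Each step descends at least half of the way to the infimum over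
    \<open>S e\<close>; the other case is that \<open>e\<close> already attains it.\<close>
  have "\<exists>d\<in>S e. snd d \<le> (I e + snd e) / 2" if e: "e \<in> E" for e
  proof (cases "I e < snd e")
    case True
    then have "I e < (I e + snd e) / 2" by simp
    then show ?thesis
      using cINF_less_iff[OF _ bdd, of e "(I e + snd e) / 2"] S_refl[OF e]
      unfolding I_def by (metis empty_iff less_imp_le)
  next
    case False
    then show ?thesis using S_refl[OF e] by (intro bexI[of _ e]) auto
  qed
  then obtain nxt where nxt: "\<And>e. e \<in> E \<Longrightarrow> nxt e \<in> S e"
      "\<And>e. e \<in> E \<Longrightarrow> snd (nxt e) \<le> (I e + snd e) / 2" by metis
  define e where "e n = (nxt ^^ n) (z, c)" for n
  have e0: "e 0 = (z, c)" and eSuc: "e (Suc n) = nxt (e n)" for n by (simp_all add: e_def)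
  have eE: "e n \<in> E" for n
    by (induction n) (use zE nxt(1) in \<open>auto simp: e0 eSuc S_def\<close>)
  have e_S: "e (n + k) \<in> S (e n)" for n k
  proof (induction k)
    case 0
    then show ?case using S_refl[OF eE] by simp
  next
    case (Suc k)
    then show ?case using S_trans nxt(1)[OF eE] by (simp add: eSuc)
  qed
  have e_le: "snd (e l) + \<epsilon> * dist (fst (e n)) (fst (e l)) \<le> snd (e n)" if "n \<le> l" for n l
    using e_S[of n "l - n"] that by (simp add: S_def)
  have "decseq (\<lambda>n. snd (e n))"
  proof (rule decseq_SucI)
    fix n
    have "0 \<le> \<epsilon> * dist (fst (e n)) (fst (e (Suc n)))" using \<epsilon> by simp
    then show "snd (e (Suc n)) \<le> snd (e n)" using e_le[of n "Suc n"] by simp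
  qed
  moreover have "m \<le> snd (e n)" for n using E(2)[of "fst (e n)" "snd (e n)"] eE by simp
  ultimately obtain r where r: "(\<lambda>n. snd (e n)) \<longlonglongrightarrow> r" "\<And>n. r \<le> snd (e n)"
    using decseq_convergent by metis
  have "Cauchy (\<lambda>n. fst (e n))"
  proof (rule metric_CauchyI)
    fix \<delta> :: real assume "\<delta> > 0"
    then have "\<epsilon> * \<delta> > 0" using \<epsilon> by simp
    then obtain N where N: "\<And>n. n \<ge> N \<Longrightarrow> snd (e n) < r + \<epsilon> * \<delta>"
      using order_tendstoD(2)[OF r(1), of "r + \<epsilon> * \<delta>"] by (auto simp: eventually_sequentially)
    have *: "dist (fst (e n)) (fst (e l)) < \<delta>" if "N \<le> n" "n \<le> l" for n l
    proof -
      have "\<epsilon> * dist (fst (e n)) (fst (e l)) < \<epsilon> * \<delta>"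
        using e_le[OF that(2)] N[OF that(1)] r(2)[of l] by linarith
      then show ?thesis using \<epsilon> by simp
    qed
    then show "\<exists>M. \<forall>n\<ge>M. \<forall>l\<ge>M. dist (fst (e n)) (fst (e l)) < \<delta>"
      by (metis dist_commute linear)
  qed
  then obtain x where x: "(\<lambda>n. fst (e n)) \<longlonglongrightarrow> x"
    using Cauchy_convergent convergent_def by blast
  have lim: "e \<longlonglongrightarrow> (x, r)"
    using tendsto_Pair[OF x r(1)] by simp
  have xS: "(x, r) \<in> S (e n)" for n
  proof (rule closed_sequentially[OF S_closed])
    show "(\<lambda>k. e (n + k)) \<longlonglongrightarrow> (x, r)"
      using LIMSEQ_ignore_initial_segment[OF lim, of n] by (simp add: add.commute)
  qed (rule e_S)
  show thesis
  proof
    show "(x, r) \<in> E" "r + \<epsilon> * dist z x \<le> c" using xS[of 0] by (simp_all add: S_def e0)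
    fix y s assume ys: "(y, s) \<in> E"
    show "r \<le> s + \<epsilon> * dist x y"
    proof (rule ccontr)
      assume "\<not> ?thesis"
      then have "(y, s) \<in> S (x, r)" and less: "s + \<epsilon> * dist x y < r" using ys by (auto simp: S_def)
      \<comment> \<open>A point violating the claim is reachable from every \<open>e n\<close>. The
        halfway rule bounds \<open>2 * snd (e (Suc n)) - snd (e n)\<close> by
        \<open>I (e n)\<close>, and in the limit \<open>r \<le> s\<close>, against the strict
        descent.\<close>
      then have "I (e n) \<le> s" for n using I_le[OF S_trans[OF xS]] by fastforce
      then have "2 * snd (e (Suc n)) - snd (e n) \<le> s" for n
        using nxt(2)[OF eE, of n] by (simp add: eSuc) (smt (verit))
      moreover have "(\<lambda>n. 2 * snd (e (Suc n)) - snd (e n)) \<longlonglongrightarrow> 2 * r - r"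
        by (intro tendsto_intros r(1) LIMSEQ_Suc)
      ultimately have "r \<le> s" using LIMSEQ_le_const2 by fastforce
      moreover have "0 \<le> \<epsilon> * dist x y" using \<epsilon> by simp
      ultimately show False using less by linarith
    qed
  qed
qed

section \<open>Subgradients of closed convex functions\<close>

text \<open>Heights are real, so lower semicontinuity and convexity become closedness and convexity
  of a subset of a normed space.\<close>

definition epi :: "('a \<Rightarrow> ereal) \<Rightarrow> ('a \<times> real) set" where
  "epi g = {(x, r). g x \<le> ereal r}"

lemma mem_epi [simp]: "(x, r) \<in> epi g \<longleftrightarrow> g x \<le> ereal r"
  by (simp add: epi_def)

lemma epi_eq_empty_iff: "epi g = {} \<longleftrightarrow> eff_dom g = {}"
proof -
  have "(\<exists>r. g x \<le> ereal r) \<longleftrightarrow> g x < \<infinity>" for x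
    by (cases "g x") auto
  then show ?thesis by (auto simp: epi_def eff_dom_def)
qed

lemma convex_epi:
  assumes "convex_fun g"
  shows "convex (epi g)"
proof (unfold convex_alt, intro ballI allI impI)
  fix p q :: "'a \<times> real" and t :: real
  assume pq: "p \<in> epi g" "q \<in> epi g" and t: "0 \<le> t \<and> t \<le> 1"
  obtain x r y s where eq: "p = (x, r)" "q = (y, s)" by (cases p, cases q)
  consider "t = 0" | "t = 1" | "0 < t" "t < 1" using t by linarith
  then show "(1 - t) *\<^sub>R p + t *\<^sub>R q \<in> epi g"
  proof cases
    case 3
    have "g ((1 - t) *\<^sub>R x + t *\<^sub>R y) \<le> ereal (1 - t) * g x + ereal t * g y"
      using assms 3 by (simp add: convex_fun_def)
    also have "\<dots> \<le> ereal (1 - t) * ereal r + ereal t * ereal s"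
      using pq eq 3 by (intro add_mono ereal_mult_left_mono) auto
    finally show ?thesis by (simp add: eq)
  qed (use pq in auto)
qed

lemma closed_epi:
  assumes "lsc g"
  shows "closed (epi g)"
proof -
  have "\<exists>T. open T \<and> p \<in> T \<and> T \<subseteq> - epi g" if p: "p \<in> - epi g" for p
  proof -
    obtain x r where eq: "p = (x, r)" by (cases p)
    then have "ereal r < g x" using p by simp
    then obtain y where y: "ereal r < y" "y < g x" using dense by blast
    then obtain s where s: "y = ereal s" by (cases y) auto
    have "eventually (\<lambda>z. y < g z) (at x)"
      using assms y(2) unfolding lsc_def le_Liminf_iff by blast
    \<comment> \<open>\<open>Liminf (at x)\<close> ignores \<open>x\<close> itself;
      \<open>y < g x\<close> supplies the missing point of the neighbourhood.\<close>
    then obtain U where U: "open U" "x \<in> U" "\<And>z. z \<in> U \<Longrightarrow> y < g z"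
      using y(2) unfolding eventually_at_topological by (metis UNIV_I)
    have "r < s" using y(1) s by simp
    moreover have "(z, q) \<notin> epi g" if "z \<in> U" "q < s" for z q
      using U(3)[OF that(1)] that(2) s by (auto simp: not_le intro: less_trans[of _ "ereal s"])
    ultimately show ?thesis
      using U(1,2) eq by (intro exI[of _ "U \<times> {..<s}"]) (auto intro: open_Times)
  qed
  then have "open (- epi g)" by (subst open_subopen) blast
  then show ?thesis by (simp add: closed_def)
qed

lemma Gamma0_epi:
  assumes "g \<in> Gamma0"
  shows "convex (epi g)" "closed (epi g)" "\<And>x. g x \<noteq> -\<infinity>" "epi g \<noteq> {}"
  using assms by (auto simp: Gamma0_def convex_epi closed_epi epi_eq_empty_iff)

lemma epi_finiteE:
  assumes "(x, r) \<in> epi g" "g x \<noteq> -\<infinity>"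
  obtains a where "g x = ereal a" "a \<le> r"
  using assms by (cases "g x") auto

lemma epi_convex_combination:
  assumes "convex (epi g)" "(x, r) \<in> epi g" "(y, s) \<in> epi g" "0 \<le> u" "0 \<le> v" "u + v = 1"
  shows "(u *\<^sub>R x + v *\<^sub>R y, u * r + v * s) \<in> epi g"
  using convexD[OF assms] by (simp del: mem_epi)

lemma subdiff_iff_epi:
  assumes "g z = ereal a"
  shows "\<xi> \<in> subdiff g z \<longleftrightarrow> (\<forall>y r. (y, r) \<in> epi g \<longrightarrow> a + blinfun_apply \<xi> (y - z) \<le> r)"
proof
  assume "\<xi> \<in> subdiff g z"
  then have "ereal (a + blinfun_apply \<xi> (y - z)) \<le> g y" for y
    using assms by (simp add: subdiff_def)
  then show "\<forall>y r. (y, r) \<in> epi g \<longrightarrow> a + blinfun_apply \<xi> (y - z) \<le> r"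
    by (metis ereal_less_eq(3) mem_epi order_trans)
next
  assume *: "\<forall>y r. (y, r) \<in> epi g \<longrightarrow> a + blinfun_apply \<xi> (y - z) \<le> r"
  have "ereal (a + blinfun_apply \<xi> (y - z)) \<le> g y" for y
  proof (rule ereal_le_real)
    show "ereal (a + blinfun_apply \<xi> (y - z)) \<le> ereal r" if "g y \<le> ereal r" for r
      using * that by simp
  qed
  then show "\<xi> \<in> subdiff g z" using assms by (simp add: subdiff_def)
qed

text \<open>Both conclusions ask for a functional below the set \<open>C\<close>, the translated
  epigraph minus the segment from \<open>(0, 0)\<close> to \<open>(h, d)\<close>: the end
  \<open>s = 0\<close> gives the subgradient inequality, the end \<open>s = 1\<close> at the base
  point gives the slope \<open>d\<close>. The assumption \<open>calm\<close> says that
  \<open>C\<close> stays above the cone.\<close>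

lemma directional_subgradient:
  fixes g :: "'a::real_normed_vector \<Rightarrow> ereal"
  assumes g: "convex (epi g)" "g z = ereal a" and L: "L \<ge> 0"
    and calm: "\<And>s v r. 0 \<le> s \<Longrightarrow> s \<le> 1 \<Longrightarrow> (z + v, r) \<in> epi g \<Longrightarrow>
      a + s * d - L * norm (v - s *\<^sub>R h) \<le> r"
  obtains \<xi> where "\<xi> \<in> subdiff g z" "d \<le> blinfun_apply \<xi> h"
proof -
  define C where "C = {(v - s *\<^sub>R h, r - a - s * d) | v r s. 0 \<le> s \<and> s \<le> 1 \<and> (z + v, r) \<in> epi g}"
  have CI: "(v - s *\<^sub>R h, r - a - s * d) \<in> C" if "0 \<le> s" "s \<le> 1" "(z + v, r) \<in> epi g" for v r s
    using that unfolding C_def by blast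
  have "convex C"
  proof (rule convexI)
    fix p q :: "'a \<times> real" and u w :: real
    assume pq: "p \<in> C" "q \<in> C" and u: "0 \<le> u" "0 \<le> w" "u + w = 1"
    obtain v1 r1 s1 where 1: "p = (v1 - s1 *\<^sub>R h, r1 - a - s1 * d)" "0 \<le> s1" "s1 \<le> 1"
        "(z + v1, r1) \<in> epi g"
      using pq(1) unfolding C_def by blast
    obtain v2 r2 s2 where 2: "q = (v2 - s2 *\<^sub>R h, r2 - a - s2 * d)" "0 \<le> s2" "s2 \<le> 1"
        "(z + v2, r2) \<in> epi g"
      using pq(2) unfolding C_def by blast
    have w: "w = 1 - u" using u by simp
    have "u *\<^sub>R (z + v1) + w *\<^sub>R (z + v2) = z + (u *\<^sub>R v1 + w *\<^sub>R v2)"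
      by (simp add: w algebra_simps)
    then have "(z + (u *\<^sub>R v1 + w *\<^sub>R v2), u * r1 + w * r2) \<in> epi g"
      using epi_convex_combination[OF g(1) 1(4) 2(4) u] by simp
    moreover have "u * s1 + w * s2 \<le> 1"
      using convex_bound_le[OF 1(3) 2(3) u] .
    ultimately have "(u *\<^sub>R v1 + w *\<^sub>R v2 - (u * s1 + w * s2) *\<^sub>R h,
        u * r1 + w * r2 - a - (u * s1 + w * s2) * d) \<in> C"
      using 1 2 u by (intro CI) auto
    moreover have "u *\<^sub>R p + w *\<^sub>R q = (u *\<^sub>R v1 + w *\<^sub>R v2 - (u * s1 + w * s2) *\<^sub>R h,
        u * r1 + w * r2 - a - (u * s1 + w * s2) * d)"
      by (simp add: 1 2 w algebra_simps)
    ultimately show "u *\<^sub>R p + w *\<^sub>R q \<in> C" by simp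
  qed
  moreover have z: "(z + 0, a) \<in> epi g" using g(2) by simp
  have "C \<noteq> {}" using CI[OF _ _ z, of 0] by auto
  moreover have "- L * norm v \<le> r" if "(v, r) \<in> C" for v r
    using that calm unfolding C_def by fastforce
  ultimately obtain \<xi> where \<xi>: "\<And>v r. (v, r) \<in> C \<Longrightarrow> blinfun_apply \<xi> v \<le> r"
    using L convex_above_cone_separation[of C L] by metis
  show thesis
  proof
    show "\<xi> \<in> subdiff g z"
      unfolding subdiff_iff_epi[of g, OF g(2)]
    proof (intro allI impI)
      fix y r assume "(y, r) \<in> epi g"
      then show "a + blinfun_apply \<xi> (y - z) \<le> r"
        using \<xi>[OF CI[of 0 "y - z" r]] by simp
    qed
    show "d \<le> blinfun_apply \<xi> h"
      using \<xi>[OF CI[OF _ _ z, of 1]] by (simp add: blinfun.minus_right)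
  qed
qed

text \<open>A bound along the ray extends to all points: \<open>z + v\<close> is combined with a
  point of the ball where \<open>g \<le> B\<close> so that the result falls back on the ray.\<close>

lemma bounded_above_imp_calm:
  fixes g :: "'a::real_normed_vector \<Rightarrow> ereal"
  assumes g: "convex (epi g)" and \<rho>: "\<rho> > 0" "\<And>u. norm u < \<rho> \<Longrightarrow> (z + u, B) \<in> epi g"
    and d: "\<And>t r. t \<ge> 0 \<Longrightarrow> (z + t *\<^sub>R h, r) \<in> epi g \<Longrightarrow> a + t * d \<le> r"
    and s: "s \<ge> 0" and v: "(z + v, r) \<in> epi g"
  shows "a + s * d - 2 * (B - a) / \<rho> * norm (v - s *\<^sub>R h) \<le> r"
proof (cases "v = s *\<^sub>R h")
  case True
  then show ?thesis using d[OF s] v by simp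
next
  case False
  \<comment> \<open>Chosen so that the correcting vector \<open>u\<close> has norm
    \<open>\<rho> / 2\<close>; the weights \<open>1 / (1 + \<kappa>)\<close> and
    \<open>\<kappa> / (1 + \<kappa>)\<close> then cancel the deviation of \<open>v\<close> from
    \<open>s *\<^sub>R h\<close>.\<close>
  define \<kappa> where "\<kappa> = 2 * norm (v - s *\<^sub>R h) / \<rho>"
  have \<kappa>: "\<kappa> > 0" using False \<rho>(1) by (simp add: \<kappa>_def)
  define u where "u = (1 / \<kappa>) *\<^sub>R (s *\<^sub>R h - v)"
  have "norm u = \<rho> / 2" using False \<rho>(1) by (simp add: u_def \<kappa>_def norm_minus_commute)
  then have u: "(z + u, B) \<in> epi g" using \<rho> by simp
  have sum1: "1 / (1 + \<kappa>) + \<kappa> / (1 + \<kappa>) = 1" using \<kappa> by (simp add: add_divide_distrib[symmetric])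
  have "((1 / (1 + \<kappa>)) *\<^sub>R (z + v) + (\<kappa> / (1 + \<kappa>)) *\<^sub>R (z + u),
      1 / (1 + \<kappa>) * r + \<kappa> / (1 + \<kappa>) * B) \<in> epi g"
    using \<kappa> by (intro epi_convex_combination[OF g v u] sum1) auto
  moreover have "(1 / (1 + \<kappa>)) *\<^sub>R (z + v) + (\<kappa> / (1 + \<kappa>)) *\<^sub>R (z + u) = z + (s / (1 + \<kappa>)) *\<^sub>R h"
  proof -
    have "(\<kappa> / (1 + \<kappa>)) *\<^sub>R u = (1 / (1 + \<kappa>)) *\<^sub>R (s *\<^sub>R h - v)" using \<kappa> by (simp add: u_def)
    then have "(1 / (1 + \<kappa>)) *\<^sub>R (z + v) + (\<kappa> / (1 + \<kappa>)) *\<^sub>R (z + u)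
        = (1 / (1 + \<kappa>) + \<kappa> / (1 + \<kappa>)) *\<^sub>R z + (s / (1 + \<kappa>)) *\<^sub>R h"
      by (simp add: scaleR_add_right scaleR_diff_right scaleR_left_distrib)
    then show ?thesis by (simp only: sum1 scaleR_one)
  qed
  ultimately have "a + s / (1 + \<kappa>) * d \<le> 1 / (1 + \<kappa>) * r + \<kappa> / (1 + \<kappa>) * B"
    using s \<kappa> by (intro d) auto
  moreover define k where "k = 1 + \<kappa>"
  ultimately have "k * (a + s / k * d) \<le> k * (1 / k * r + \<kappa> / k * B)"
    using \<kappa> by (intro mult_left_mono) auto
  moreover have k: "k > 0" using \<kappa> by (simp add: k_def)
  ultimately have "k * a + s * d \<le> r + \<kappa> * B"
    using k by (simp add: distrib_left)
  then have "a + s * d - \<kappa> * (B - a) \<le> r" by (simp add: k_def algebra_simps)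
  moreover have "\<kappa> * (B - a) = 2 * (B - a) / \<rho> * norm (v - s *\<^sub>R h)" by (simp add: \<kappa>_def)
  ultimately show ?thesis by linarith
qed

text \<open>The sublevel sets at integer heights absorb every direction around an interior point, so
  one of them contains a ball. The factor \<open>{0}\<close> in \<open>D\<close> only fits them into
  the projection lemma.\<close>

lemma closed_convex_bounded_above:
  fixes g :: "'a::banach \<Rightarrow> ereal"
  assumes g: "convex (epi g)" "closed (epi g)" and z: "z \<in> interior (eff_dom g)"
  obtains B \<rho> where "\<rho> > 0" "\<And>u. norm u < \<rho> \<Longrightarrow> (z + u, B) \<in> epi g"
proof -
  define D where "D n = {0::real} \<times> {w. (z + w, real n) \<in> epi g}" for n :: nat
  have "convex {w. (z + w, real n) \<in> epi g}" for n
  proof (rule convexI)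
    fix x y and u v :: real
    assume xy: "x \<in> {w. (z + w, real n) \<in> epi g}" "y \<in> {w. (z + w, real n) \<in> epi g}"
      and u: "0 \<le> u" "0 \<le> v" "u + v = 1"
    have v: "v = 1 - u" using u by simp
    have "u *\<^sub>R (z + x) + v *\<^sub>R (z + y) = z + (u *\<^sub>R x + v *\<^sub>R y)" "u * real n + v * real n = real n"
      by (simp_all add: v algebra_simps)
    then show "u *\<^sub>R x + v *\<^sub>R y \<in> {w. (z + w, real n) \<in> epi g}"
      using epi_convex_combination[OF g(1) _ _ u, of "z + x" "real n" "z + y" "real n"] xy
      by simp
  qed
  then have 1: "convex (D n)" for n
    unfolding D_def by (intro convex_Times) auto
  have "closed ((\<lambda>w. (z + w, real n)) -` epi g)" for n
    by (intro closed_vimage g(2)) (auto intro!: continuous_intros)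
  then have 2: "closed (D n)" for n
    unfolding D_def by (intro closed_Times) (auto simp: vimage_def)
  have 3: "bounded (fst ` D n)" for n
    by (rule bounded_subset[of "{0}"]) (auto simp: D_def)
  have 4: "D m \<subseteq> D n" if "m \<le> n" for m n
    using that by (auto simp: D_def intro: order_trans)
  have 5: "\<exists>n. \<exists>t>0. t *\<^sub>R w \<in> snd ` D n" for w
  proof -
    obtain e where e: "e > 0" "ball z e \<subseteq> eff_dom g"
      using z by (auto simp: mem_interior)
    define t where "t = e / (2 * (norm w + 1))"
    have nw: "0 < norm w + 1" using norm_ge_zero[of w] by linarith
    have t: "t > 0" using e nw by (simp add: t_def)
    have "norm (t *\<^sub>R w) < e"
    proof -
      have "norm w < 2 * (norm w + 1)" using nw by (simp add: algebra_simps)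
      then have "e * norm w < e * (2 * (norm w + 1))" using e(1) by simp
      then show ?thesis using e(1) nw by (simp add: t_def pos_divide_less_eq)
    qed
    then have "z + t *\<^sub>R w \<in> eff_dom g" using e(2) by (auto simp: dist_norm)
    then have "g (z + t *\<^sub>R w) < \<infinity>" by (simp add: eff_dom_def)
    then obtain n :: nat where "g (z + t *\<^sub>R w) \<le> ereal (real n)"
      by (metis less_PInf_Ex_of_nat less_imp_le less_irrefl)
    then show ?thesis using t by (force simp: D_def)
  qed
  obtain n \<rho> where "\<rho> > 0" "ball 0 \<rho> \<inter> UNIV \<subseteq> snd ` D n"
    by (rule convex_closed_projection_absorbing[of D UNIV, OF 1 2 3 4]) (use 5 in auto)
  then show thesis by (intro that[of \<rho> "real n"]) (auto simp: D_def)
qed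

lemma interior_directional_subgradient:
  fixes g :: "'a::banach \<Rightarrow> ereal"
  assumes g: "convex (epi g)" "closed (epi g)" "g z = ereal a" and z: "z \<in> interior (eff_dom g)"
    and d: "\<And>t r. t \<ge> 0 \<Longrightarrow> (z + t *\<^sub>R h, r) \<in> epi g \<Longrightarrow> a + t * d \<le> r"
  obtains \<xi> where "\<xi> \<in> subdiff g z" "d \<le> blinfun_apply \<xi> h"
proof -
  obtain B \<rho> where B: "\<rho> > 0" "\<And>u. norm u < \<rho> \<Longrightarrow> (z + u, B) \<in> epi g"
    using closed_convex_bounded_above[OF g(1,2) z] by metis
  have "a \<le> B" using B(2)[of 0] B(1) g(3) by simp
  then have "2 * (B - a) / \<rho> \<ge> 0" using B(1) by simp
  then show thesis
    using directional_subgradient[OF g(1,3)] bounded_above_imp_calm[OF g(1) B d] that by metis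
qed

lemma interior_subdiff_nonempty:
  fixes g :: "'a::banach \<Rightarrow> ereal"
  assumes g: "convex (epi g)" "closed (epi g)" "g z = ereal a" and z: "z \<in> interior (eff_dom g)"
  shows "subdiff g z \<noteq> {}"
proof -
  have "a + t * 0 \<le> r" if "(z + t *\<^sub>R 0, r) \<in> epi g" for t r
    using that g(3) by simp
  then show ?thesis using interior_directional_subgradient[OF g z, of 0 0] by blast
qed

text \<open>If the slope along \<open>h\<close> never fell below \<open>p h + \<epsilon>\<close>,
  some subgradient would have at least that slope, against uniqueness. One good \<open>t0\<close>
  then serves all smaller \<open>t\<close> by convexity.\<close>

lemma unique_subgradient_difference_quotient:
  fixes g :: "'a::banach \<Rightarrow> ereal"
  assumes g: "convex (epi g)" "closed (epi g)" "\<And>x. g x \<noteq> -\<infinity>" "g z = ereal a"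
    and z: "z \<in> interior (eff_dom g)" and p: "subdiff g z = {p}" and \<epsilon>: "\<epsilon> > 0"
  obtains t0 where "t0 > 0"
    "\<And>t. 0 < t \<Longrightarrow> t \<le> t0 \<Longrightarrow> \<exists>r. g (z + t *\<^sub>R h) = ereal r \<and>
      a + t * blinfun_apply p h \<le> r \<and> r < a + t * (blinfun_apply p h + \<epsilon>)"
proof -
  have "\<exists>t r. t \<ge> 0 \<and> (z + t *\<^sub>R h, r) \<in> epi g \<and> r < a + t * (blinfun_apply p h + \<epsilon>)"
  proof (rule ccontr)
    assume "\<not> ?thesis"
    then have "a + t * (blinfun_apply p h + \<epsilon>) \<le> r" if "t \<ge> 0" "(z + t *\<^sub>R h, r) \<in> epi g" for t r
      using that by force
    then obtain \<xi> where "\<xi> \<in> subdiff g z" "blinfun_apply p h + \<epsilon> \<le> blinfun_apply \<xi> h"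
      using interior_directional_subgradient[OF g(1,2,4) z] by metis
    then show False using p \<epsilon> by simp
  qed
  then obtain t0 r0 where t0: "t0 \<ge> 0" "(z + t0 *\<^sub>R h, r0) \<in> epi g" "r0 < a + t0 * (blinfun_apply p h + \<epsilon>)"
    by blast
  have "t0 \<noteq> 0" using t0(2,3) g(4) by auto
  then have t0_pos: "t0 > 0" using t0(1) by simp
  have sub: "a + blinfun_apply p (y - z) \<le> r" if "(y, r) \<in> epi g" for y r
    using p subdiff_iff_epi[of g, OF g(4)] that by blast
  show thesis
  proof
    show "t0 > 0" by (rule t0_pos)
    fix t assume t: "0 < t" "t \<le> t0"
    define c where "c = t / t0"
    have c: "0 < c" "c \<le> 1" "c * t0 = t" using t t0_pos by (simp_all add: c_def)
    have "((1 - c) *\<^sub>R z + c *\<^sub>R (z + t0 *\<^sub>R h), (1 - c) * a + c * r0) \<in> epi g"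
      using c g(4) t0(2) by (intro epi_convex_combination[OF g(1)]) auto
    moreover have "(1 - c) *\<^sub>R z + c *\<^sub>R (z + t0 *\<^sub>R h) = z + t *\<^sub>R h"
      using c(3) by (simp add: algebra_simps)
    ultimately have mem: "(z + t *\<^sub>R h, (1 - c) * a + c * r0) \<in> epi g" by (simp del: mem_epi)
    then obtain r where r: "g (z + t *\<^sub>R h) = ereal r" "r \<le> (1 - c) * a + c * r0"
      using epi_finiteE[OF mem g(3)] by blast
    have "c * r0 < c * (a + t0 * (blinfun_apply p h + \<epsilon>))" using c(1) t0(3) by simp
    also have "\<dots> = c * a + t * (blinfun_apply p h + \<epsilon>)"
      by (simp only: distrib_left mult.assoc[symmetric] c(3))
    finally have "r < a + t * (blinfun_apply p h + \<epsilon>)" using r(2) by (simp add: algebra_simps)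
    moreover have "a + t * blinfun_apply p h \<le> r"
      using sub[of "z + t *\<^sub>R h" r] r(1) by (simp add: blinfun.scaleR_right)
    ultimately show "\<exists>r. g (z + t *\<^sub>R h) = ereal r \<and> a + t * blinfun_apply p h \<le> r \<and>
        r < a + t * (blinfun_apply p h + \<epsilon>)"
      using r(1) by blast
  qed
qed

lemma unique_subgradient_has_gateaux_gradient:
  fixes g :: "'a::banach \<Rightarrow> ereal"
  assumes g: "convex (epi g)" "closed (epi g)" "\<And>x. g x \<noteq> -\<infinity>"
    and z: "z \<in> interior (eff_dom g)" and p: "subdiff g z = {p}"
  shows "has_gateaux_gradient g z p"
  unfolding has_gateaux_gradient_def
proof (intro conjI allI z)
  fix h
  have "g z < \<infinity>" using z interior_subset by (auto simp: eff_dom_def)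
  then obtain a where a: "g z = ereal a" using g(3)[of z] by (cases "g z") auto
  show "((\<lambda>t. (real_of_ereal (g (z + t *\<^sub>R h)) - real_of_ereal (g z)) / t) \<longlongrightarrow> blinfun_apply p h) (at 0)"
  proof (rule LIM_I)
    fix \<epsilon> :: real assume \<epsilon>: "0 < \<epsilon>"
    obtain t1 where t1: "t1 > 0" "\<And>t. 0 < t \<Longrightarrow> t \<le> t1 \<Longrightarrow> \<exists>r. g (z + t *\<^sub>R h) = ereal r \<and>
        a + t * blinfun_apply p h \<le> r \<and> r < a + t * (blinfun_apply p h + \<epsilon>)"
      using unique_subgradient_difference_quotient[OF g a z p \<epsilon>] by metis
    \<comment> \<open>The direction \<open>- h\<close> handles negative \<open>t\<close>.\<close>
    obtain t2 where t2: "t2 > 0" "\<And>t. 0 < t \<Longrightarrow> t \<le> t2 \<Longrightarrow> \<exists>r. g (z + t *\<^sub>R - h) = ereal r \<and>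
        a + t * blinfun_apply p (- h) \<le> r \<and> r < a + t * (blinfun_apply p (- h) + \<epsilon>)"
      using unique_subgradient_difference_quotient[OF g a z p \<epsilon>] by metis
    show "\<exists>s>0. \<forall>t. t \<noteq> 0 \<and> norm (t - 0) < s \<longrightarrow>
      norm ((real_of_ereal (g (z + t *\<^sub>R h)) - real_of_ereal (g z)) / t - blinfun_apply p h) < \<epsilon>"
    proof (intro exI conjI allI impI)
      show "0 < min t1 t2" using t1 t2 by simp
      fix t :: real assume t: "t \<noteq> 0 \<and> norm (t - 0) < min t1 t2"
      show "norm ((real_of_ereal (g (z + t *\<^sub>R h)) - real_of_ereal (g z)) / t - blinfun_apply p h) < \<epsilon>"
      proof (cases "t > 0")
        case True
        then obtain r where r: "g (z + t *\<^sub>R h) = ereal r" "a + t * blinfun_apply p h \<le> r"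
            "r < a + t * (blinfun_apply p h + \<epsilon>)"
          using t t1(2)[of t] by auto
        have "0 \<le> (r - a) / t - blinfun_apply p h" "(r - a) / t - blinfun_apply p h < \<epsilon>"
          using r True by (simp_all add: field_simps)
        then show ?thesis using r(1) a by simp
      next
        case False
        then have neg: "- t > 0" using t by simp
        then obtain r where r: "g (z + (- t) *\<^sub>R - h) = ereal r" "a + (- t) * blinfun_apply p (- h) \<le> r"
            "r < a + (- t) * (blinfun_apply p (- h) + \<epsilon>)"
          using t t2(2)[of "- t"] by auto
        have r': "g (z + t *\<^sub>R h) = ereal r" using r(1) by simp
        have "(r - a) / t - blinfun_apply p h \<le> 0" "- \<epsilon> < (r - a) / t - blinfun_apply p h"
          using r(2,3) neg by (simp_all add: field_simps blinfun.minus_right)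
        then show ?thesis using r' a \<epsilon> by simp
      qed
    qed
  qed
qed

lemma grad_eq:
  assumes "has_gateaux_gradient g z p"
  shows "grad g z = p"
  unfolding grad_def
proof (rule the_equality)
  show "has_gateaux_gradient g z p" by (rule assms)
  fix q assume "has_gateaux_gradient g z q"
  then have "blinfun_apply q h = blinfun_apply p h" for h
    using assms unfolding has_gateaux_gradient_def by (blast intro: tendsto_unique[OF at_neq_bot])
  then show "q = p" by (rule blinfun_eqI)
qed

text \<open>
  Outside the domain, a point \<open>w\<close> close to \<open>z\<close> would yield, by Ekeland's principle for
  \<open>g + L * norm (w - \<cdot>)\<close>, a subgradient of norm at least \<open>L - 1\<close> near \<open>z\<close>.
\<close>

lemma locally_bounded_subdiff_interior:
  fixes g :: "'a::banach \<Rightarrow> ereal"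
  assumes g: "convex (epi g)" "closed (epi g)" "\<And>x. g x \<noteq> -\<infinity>" "g z = ereal a"
    and z: "subdiff g z \<noteq> {}" and \<rho>: "\<rho> > 0" "bounded (\<Union>w\<in>ball z \<rho>. subdiff g w)"
  shows "z \<in> interior (eff_dom g)"
proof -
  obtain M where M: "M > 0" "\<And>w p. w \<in> ball z \<rho> \<Longrightarrow> p \<in> subdiff g w \<Longrightarrow> norm p \<le> M"
    using \<rho>(2) unfolding bounded_pos by blast
  obtain p0 where p0: "p0 \<in> subdiff g z" using z by blast
  have low: "a - M * norm (y - z) \<le> r" if "(y, r) \<in> epi g" for y r
  proof -
    have "\<bar>blinfun_apply p0 (y - z)\<bar> \<le> norm p0 * norm (y - z)"
      using norm_blinfun[of p0 "y - z"] by simp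
    also have "\<dots> \<le> M * norm (y - z)" using M(2)[OF _ p0] \<rho>(1) by (intro mult_right_mono) auto
    moreover have "a + blinfun_apply p0 (y - z) \<le> r" using p0 subdiff_iff_epi[of g, OF g(4)] that by blast
    ultimately show ?thesis by linarith
  qed
  \<comment> \<open>Of the two units above \<open>M\<close>, one pays for Ekeland's perturbation
    with constant 1; the other makes the resulting slope \<open>M + 1\<close> exceed the bound on
    the subgradients.\<close>
  define L where "L = M + 2"
  have "w \<in> eff_dom g" if w: "w \<in> ball z (\<rho> / L)" for w
  proof (rule ccontr)
    assume notin: "w \<notin> eff_dom g"
    have wz: "L * norm (w - z) < \<rho>"
      using w M(1) by (simp add: L_def dist_norm norm_minus_commute field_simps)
    \<comment> \<open>The epigraph of \<open>v \<mapsto> g v + L * norm (w - v)\<close>.\<close>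
    define E where "E = {(v, s). (v, s - L * norm (w - v)) \<in> epi g}"
    have "E = (\<lambda>(v, s). (v, s - L * norm (w - v))) -` epi g" by (auto simp: E_def)
    moreover have "closed ((\<lambda>(v, s). (v, s - L * norm (w - v))) -` epi g)"
      by (intro closed_vimage g(2)) (auto simp: case_prod_beta intro!: continuous_intros)
    ultimately have "closed E" by simp
    moreover have "a - M * norm (w - z) \<le> s" if "(v, s) \<in> E" for v s
    proof -
      have "a - M * norm (v - z) + L * norm (w - v) \<le> s" using low that by (fastforce simp: E_def)
      moreover have "M * norm (v - z) \<le> M * (norm (w - v) + norm (w - z))"
        using M(1) norm_triangle_ineq4[of "w - z" "w - v"] by (intro mult_left_mono) auto
      moreover have "M * norm (w - v) \<le> L * norm (w - v)"
        by (intro mult_right_mono) (simp_all add: L_def)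
      ultimately show ?thesis by (simp add: distrib_left)
    qed
    moreover have "(z, a + L * norm (w - z)) \<in> E" using g(4) by (simp add: E_def)
    ultimately obtain v s where v: "(v, s) \<in> E" "s + 1 * dist z v \<le> a + L * norm (w - z)"
        "\<And>y t. (y, t) \<in> E \<Longrightarrow> s \<le> t + 1 * dist v y"
      using ekeland_epigraph[of E _ 1 z] zero_less_one by metis
    have mem: "(v, s - L * norm (w - v)) \<in> epi g" using v(1) by (simp add: E_def)
    then obtain b where b: "g v = ereal b" "b \<le> s - L * norm (w - v)" using epi_finiteE g(3) by metis
    have min: "b + L * norm (w - v) \<le> t + L * norm (w - y) + norm (v - y)" if "(y, t) \<in> epi g" for y t
      using v(3)[of y "t + L * norm (w - y)"] b(2) that by (simp add: E_def dist_norm)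
    \<comment> \<open>The factor 3 is \<open>L - M + 1\<close>; with
      \<open>L * norm (w - z) < \<rho>\<close> this places \<open>v\<close> within two thirds of
      \<open>\<rho>\<close> from \<open>z\<close>, where \<open>M\<close> bounds the
      subgradients.\<close>
    have "v \<in> ball z \<rho>"
    proof -
      have "a - M * norm (v - z) + L * norm (w - v) + norm (v - z) \<le> a + L * norm (w - z)"
        using low[OF mem] v(2) by (simp add: dist_norm norm_minus_commute)
      moreover have "L * norm (v - z) \<le> L * (norm (w - v) + norm (w - z))"
        using M(1) norm_triangle_ineq4[of "w - z" "w - v"] by (intro mult_left_mono) (auto simp: L_def)
      ultimately have "3 * norm (v - z) \<le> 2 * (L * norm (w - z))" by (simp add: L_def algebra_simps)
      then show ?thesis using wz \<rho>(1) by (simp add: dist_norm norm_minus_commute)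
    qed
    \<comment> \<open>Moving from \<open>v\<close> a fraction \<open>s\<close> of the way to
      \<open>w\<close> lowers the penalty by \<open>s * L * norm (w - v)\<close> and costs at most
      \<open>s * norm (w - v)\<close> in Ekeland's term, so \<open>g\<close> must rise with slope
      \<open>L - 1\<close>. Deviations from the segment cost the two Lipschitz constants,
      \<open>L + 1\<close>.\<close>
    moreover obtain \<xi> where \<xi>: "\<xi> \<in> subdiff g v" "(M + 1) * norm (w - v) \<le> blinfun_apply \<xi> (w - v)"
    proof (rule directional_subgradient[OF g(1) b(1), of "L + 1" "(M + 1) * norm (w - v)" "w - v"])
      fix s u r assume s: "0 \<le> s" "s \<le> (1::real)" and "(v + u, r) \<in> epi g"
      then have "b + L * norm (w - v) \<le> r + L * norm (w - (v + u)) + norm u"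
        using min[of "v + u" r] by simp
      moreover have "norm (w - (v + u)) \<le> (1 - s) * norm (w - v) + norm (u - s *\<^sub>R (w - v))"
      proof -
        have "w - (v + u) = (1 - s) *\<^sub>R (w - v) - (u - s *\<^sub>R (w - v))" by (simp add: algebra_simps)
        then have "norm (w - (v + u)) \<le> norm ((1 - s) *\<^sub>R (w - v)) + norm (u - s *\<^sub>R (w - v))"
          by (metis norm_triangle_ineq4)
        then show ?thesis using s by simp
      qed
      then have "L * norm (w - (v + u)) \<le> L * ((1 - s) * norm (w - v) + norm (u - s *\<^sub>R (w - v)))"
        using M(1) by (intro mult_left_mono) (auto simp: L_def)
      moreover have "norm u \<le> s * norm (w - v) + norm (u - s *\<^sub>R (w - v))"
        using norm_triangle_ineq[of "s *\<^sub>R (w - v)" "u - s *\<^sub>R (w - v)"] s by simp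
      ultimately show "b + s * ((M + 1) * norm (w - v)) - (L + 1) * norm (u - s *\<^sub>R (w - v)) \<le> r"
        by (simp add: L_def algebra_simps)
    qed (use M(1) in \<open>auto simp: L_def\<close>)
    ultimately have "norm \<xi> \<le> M" using M(2) by blast
    then have "norm \<xi> * norm (w - v) \<le> M * norm (w - v)" by (intro mult_right_mono) auto
    moreover have "blinfun_apply \<xi> (w - v) \<le> norm \<xi> * norm (w - v)"
      using norm_blinfun[of \<xi> "w - v"] by simp
    moreover have "(M + 1) * norm (w - v) = M * norm (w - v) + norm (w - v)" by (simp add: distrib_right)
    ultimately have "norm (w - v) \<le> 0" using \<xi>(2) by linarith
    then have "w = v" by simp
    then show False using notin b(1) by (simp add: eff_dom_def)
  qed
  moreover have "\<rho> / L > 0" using \<rho>(1) M(1) by (simp add: L_def)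
  ultimately show ?thesis unfolding mem_interior by blast
qed

section \<open>Conjugates and Legendre functions\<close>

lemma mem_epi_conjugate_iff:
  "(p, s) \<in> epi (conjugate g) \<longleftrightarrow> (\<forall>y r. (y, r) \<in> epi g \<longrightarrow> blinfun_apply p y - r \<le> s)"
proof -
  have "ereal (blinfun_apply p y) - g y \<le> ereal s \<longleftrightarrow> (\<forall>r. g y \<le> ereal r \<longrightarrow> blinfun_apply p y - r \<le> s)" for y
  proof (cases "g y")
    case MInf
    have "\<not> blinfun_apply p y - (blinfun_apply p y - s - 1) \<le> s" by simp
    then have "\<exists>r. \<not> blinfun_apply p y - r \<le> s" by blast
    then show ?thesis using MInf by simp
  qed force+
  then show ?thesis by (auto simp: conjugate_def SUP_le_iff)
qed

lemma conjugate_ge: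
  assumes "(y, r) \<in> epi g"
  shows "ereal (blinfun_apply p y - r) \<le> conjugate g p"
proof (rule ereal_le_real)
  show "ereal (blinfun_apply p y - r) \<le> ereal s" if "conjugate g p \<le> ereal s" for s
    using that assms mem_epi_conjugate_iff[of p s g] by auto
qed

lemma epi_conjugate:
  shows "convex (epi (conjugate g))" and "closed (epi (conjugate g))"
    and "epi g \<noteq> {} \<Longrightarrow> conjugate g p \<noteq> -\<infinity>"
proof -
  define H where "H y r = {(p, s). blinfun_apply p y - r \<le> s}" for y :: 'a and r :: real
  have eq: "epi (conjugate g) = (\<Inter>(y, r)\<in>epi g. H y r)"
    unfolding H_def by (auto simp: mem_epi_conjugate_iff simp del: mem_epi)
  have "convex (H y r)" for y r
  proof (rule convexI)
    fix a b :: "('a \<Rightarrow>\<^sub>L real) \<times> real" and u v :: real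
    assume *: "a \<in> H y r" "b \<in> H y r"
      and u: "0 \<le> u" "0 \<le> v" "u + v = 1"
    obtain p s q t where ab: "a = (p, s)" "b = (q, t)" by (cases a, cases b)
    have "u * (blinfun_apply p y - r) + v * (blinfun_apply q y - r) \<le> u * s + v * t"
      using * u ab by (intro add_mono mult_left_mono) (auto simp: H_def)
    moreover have "u * r + v * r = r" using u by (simp flip: distrib_right)
    ultimately show "u *\<^sub>R a + v *\<^sub>R b \<in> H y r"
      by (simp add: H_def ab blinfun.add_left blinfun.scaleR_left algebra_simps)
  qed
  then show "convex (epi (conjugate g))" unfolding eq by (intro convex_INT) auto
  have "closed (H y r)" for y r
    unfolding H_def case_prod_beta' by (intro closed_Collect_le continuous_intros)
  then show "closed (epi (conjugate g))" unfolding eq by (intro closed_INT) auto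
  assume "epi g \<noteq> {}"
  then obtain y r where "(y, r) \<in> epi g" by (metis ex_in_conv surj_pair)
  then show "conjugate g p \<noteq> -\<infinity>" using conjugate_ge[of y r g p] by auto
qed

section \<open>Lipschitz minorants and the Fenchel--Moreau theorem\<close>

lemma closed_epi_gap:
  fixes g :: "'a::real_normed_vector \<Rightarrow> ereal"
  assumes "closed (epi g)" "(z, c) \<notin> epi g"
  obtains \<rho> where "\<rho> > 0" "\<And>y r. norm (y - z) < \<rho> \<Longrightarrow> (y, r) \<in> epi g \<Longrightarrow> c < r"
proof -
  have "closed ((\<lambda>y. (y, c)) -` epi g)"
    by (intro closed_vimage assms(1)) (auto intro!: continuous_intros)
  then have "open (- ((\<lambda>y. (y, c)) -` epi g))" by (rule open_Compl)
  moreover have "z \<in> - ((\<lambda>y. (y, c)) -` epi g)" using assms(2) by simp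
  ultimately obtain \<rho> where \<rho>: "\<rho> > 0" "ball z \<rho> \<subseteq> - ((\<lambda>y. (y, c)) -` epi g)"
    by (rule openE)
  show thesis
  proof
    show "\<rho> > 0" by (rule \<rho>)
    fix y r assume y: "norm (y - z) < \<rho>" "(y, r) \<in> epi g"
    then have "y \<in> ball z \<rho>" by (simp add: dist_norm norm_minus_commute)
    then have "\<not> g y \<le> ereal c" using \<rho>(2) by auto
    then show "c < r" using y(2) order_trans[of "g y" "ereal r" "ereal c"] by force
  qed
qed

text \<open>Closedness bounds \<open>g\<close> below by \<open>a - 1\<close> on a ball around a
  point of its domain; convexity carries the bound outwards, since a steeper descent far away would
  be felt inside the ball.\<close>

lemma Lipschitz_minorant:
  fixes g :: "'a::real_normed_vector \<Rightarrow> ereal"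
  assumes g: "convex (epi g)" "closed (epi g)" "\<And>x. g x \<noteq> -\<infinity>" "epi g \<noteq> {}"
  obtains \<alpha> L where "L \<ge> 0" "\<And>y r. (y, r) \<in> epi g \<Longrightarrow> \<alpha> - L * norm (y - z) \<le> r"
proof -
  obtain x0 a0 where x0: "(x0, a0) \<in> epi g" using g(4) by (metis ex_in_conv surj_pair)
  then obtain a where a: "g x0 = ereal a" using epi_finiteE g(3) by metis
  then have "(x0, a - 1) \<notin> epi g" by simp
  then obtain \<rho> where \<rho>: "\<rho> > 0" "\<And>y r. norm (y - x0) < \<rho> \<Longrightarrow> (y, r) \<in> epi g \<Longrightarrow> a - 1 < r"
    using closed_epi_gap[OF g(2)] by metis
  have low: "a - 1 - 2 / \<rho> * norm (y - x0) \<le> r" if yr: "(y, r) \<in> epi g" for y r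
  proof (cases "norm (y - x0) < \<rho>")
    case True
    have "0 \<le> 2 / \<rho> * norm (y - x0)" using \<rho>(1) by simp
    then show ?thesis using \<rho>(2)[OF True yr] by linarith
  next
    case False
    \<comment> \<open>Pulls \<open>y\<close> back to distance \<open>\<rho> / 2\<close> from
      \<open>x0\<close>, hence the slope \<open>2 / \<rho>\<close>.\<close>
    define \<tau> where "\<tau> = \<rho> / (2 * norm (y - x0))"
    have n: "norm (y - x0) > 0" using False \<rho>(1) by linarith
    have \<tau>: "0 < \<tau>" "\<tau> \<le> 1" using n False \<rho>(1) by (simp_all add: \<tau>_def field_simps)
    have "((1 - \<tau>) *\<^sub>R x0 + \<tau> *\<^sub>R y, (1 - \<tau>) * a + \<tau> * r) \<in> epi g"
      using \<tau> a yr by (intro epi_convex_combination[OF g(1)]) auto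
    moreover have "norm ((1 - \<tau>) *\<^sub>R x0 + \<tau> *\<^sub>R y - x0) < \<rho>"
    proof -
      have "(1 - \<tau>) *\<^sub>R x0 + \<tau> *\<^sub>R y - x0 = \<tau> *\<^sub>R (y - x0)" by (simp add: algebra_simps)
      then have "norm ((1 - \<tau>) *\<^sub>R x0 + \<tau> *\<^sub>R y - x0) = \<tau> * norm (y - x0)" using \<tau> by simp
      also have "\<dots> = \<rho> / 2" using n by (simp add: \<tau>_def)
      finally show ?thesis using \<rho>(1) by simp
    qed
    ultimately have "a - 1 < (1 - \<tau>) * a + \<tau> * r" by (intro \<rho>(2)) auto
    then have "\<tau> * (a - r) < 1" by (simp add: algebra_simps)
    then have "a - r < 1 / \<tau>" using \<tau>(1) by (simp add: field_simps)
    moreover have "1 / \<tau> = 2 / \<rho> * norm (y - x0)" by (simp add: \<tau>_def)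
    ultimately show ?thesis by linarith
  qed
  show thesis
  proof
    show "2 / \<rho> \<ge> 0" using \<rho>(1) by simp
    fix y r assume "(y, r) \<in> epi g"
    moreover have "2 / \<rho> * norm (y - x0) \<le> 2 / \<rho> * (norm (y - z) + norm (z - x0))"
      using \<rho>(1) norm_triangle_ineq[of "y - z" "z - x0"] by (intro mult_left_mono) auto
    ultimately show "a - 1 - 2 / \<rho> * norm (z - x0) - 2 / \<rho> * norm (y - z) \<le> r"
      using low[of y r] unfolding distrib_left by linarith
  qed
qed

text \<open>The Fenchel--Moreau theorem: a level \<open>c\<close> strictly between \<open>t\<close>
  and \<open>g z\<close> is the vertex of a cone below the epigraph, and the separating functional
  is an affine minorant with value \<open>c\<close> at \<open>z\<close>.\<close>

lemma biconjugate_ge: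
  fixes g :: "'a::real_normed_vector \<Rightarrow> ereal"
  assumes g: "g \<in> Gamma0"
    and t: "\<And>\<xi> s. (\<xi>, s) \<in> epi (conjugate g) \<Longrightarrow> blinfun_apply \<xi> z - s \<le> t"
  shows "(z, t) \<in> epi g"
proof (rule ccontr)
  note epi = Gamma0_epi[OF g]
  assume "(z, t) \<notin> epi g"
  then have "ereal t < g z" by simp
  then obtain c where c: "t < c" "ereal c < g z"
    using ereal_dense2 by (metis ereal_less(2) less_ereal.simps(1))
  then have "(z, c) \<notin> epi g" by simp
  then obtain \<rho> where \<rho>: "\<rho> > 0" "\<And>y r. norm (y - z) < \<rho> \<Longrightarrow> (y, r) \<in> epi g \<Longrightarrow> c < r"
    using closed_epi_gap[OF epi(2)] by metis
  obtain \<alpha> L0 where L0: "L0 \<ge> 0" "\<And>y r. (y, r) \<in> epi g \<Longrightarrow> \<alpha> - L0 * norm (y - z) \<le> r"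
    using Lipschitz_minorant[OF epi] by metis
  \<comment> \<open>Near \<open>z\<close> the gap at level \<open>c\<close> suffices for the cone;
    at distance at least \<open>\<rho>\<close> the extra slope makes up the difference between
    \<open>c\<close> and the constant \<open>\<alpha>\<close> of the Lipschitz minorant.\<close>
  define L where "L = L0 + \<bar>c - \<alpha>\<bar> / \<rho>"
  have L: "L \<ge> 0" using L0(1) \<rho>(1) by (simp add: L_def)
  have low: "c - L * norm (y - z) \<le> r" if yr: "(y, r) \<in> epi g" for y r
  proof (cases "norm (y - z) < \<rho>")
    case True
    have "0 \<le> L * norm (y - z)" using L by simp
    then show ?thesis using \<rho>(2)[OF True yr] by linarith
  next
    case False
    then have "\<bar>c - \<alpha>\<bar> / \<rho> * \<rho> \<le> \<bar>c - \<alpha>\<bar> / \<rho> * norm (y - z)"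
      using \<rho>(1) by (intro mult_left_mono) auto
    then have "c - \<alpha> \<le> \<bar>c - \<alpha>\<bar> / \<rho> * norm (y - z)" using \<rho>(1) by simp
    then show ?thesis using L0(2)[OF yr] by (simp add: L_def distrib_right)
  qed
  define C where "C = (+) (- z, - c) ` epi g"
  have "convex C" unfolding C_def by (rule convex_translation[OF epi(1)])
  moreover have "C \<noteq> {}" using epi(4) by (simp add: C_def)
  moreover have "- L * norm v \<le> r" if "(v, r) \<in> C" for v r
    using that low by (force simp: C_def simp del: mem_epi)
  ultimately obtain \<xi> where \<xi>: "\<And>v r. (v, r) \<in> C \<Longrightarrow> blinfun_apply \<xi> v \<le> r"
    using convex_above_cone_separation[of C L] L by metis
  have "(\<xi>, blinfun_apply \<xi> z - c) \<in> epi (conjugate g)"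
    unfolding mem_epi_conjugate_iff
  proof (intro allI impI)
    fix y r assume "(y, r) \<in> epi g"
    then have "(- z, - c) + (y, r) \<in> C" unfolding C_def by (rule imageI)
    then have "blinfun_apply \<xi> (y - z) \<le> r - c" using \<xi>[of "y - z" "r - c"] by simp
    then show "blinfun_apply \<xi> y - r \<le> blinfun_apply \<xi> z - c" by (simp add: blinfun.diff_right)
  qed
  from t[OF this] show False using c(1) by simp
qed

lemma subdiff_finite:
  assumes "p \<in> subdiff g z" "\<And>x. g x \<noteq> -\<infinity>" "epi g \<noteq> {}"
  obtains a where "g z = ereal a"
proof -
  obtain y r where "(y, r) \<in> epi g" using assms(3) by (metis ex_in_conv surj_pair)
  moreover have "g z + ereal (blinfun_apply p (y - z)) \<le> g y" using assms(1) by (simp add: subdiff_def)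
  ultimately have "g z \<noteq> \<infinity>" by auto
  then show thesis using assms(2)[of z] that by (cases "g z") auto
qed

lemma conjugate_eq_on_subdiff:
  assumes z: "g z = ereal a" and p: "p \<in> subdiff g z"
  shows "conjugate g p = ereal (blinfun_apply p z - a)"
proof (rule antisym)
  have "(p, blinfun_apply p z - a) \<in> epi (conjugate g)"
    unfolding mem_epi_conjugate_iff
    using p unfolding subdiff_iff_epi[of g, OF z] by (fastforce simp: blinfun.diff_right)
  then show "conjugate g p \<le> ereal (blinfun_apply p z - a)" by simp
  show "ereal (blinfun_apply p z - a) \<le> conjugate g p" by (rule conjugate_ge) (simp add: z)
qed

lemma subdiff_if_conjugate_le:
  assumes z: "g z = ereal a" and p: "conjugate g p \<le> ereal (blinfun_apply p z - a)"
  shows "p \<in> subdiff g z"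
proof -
  have "(p, blinfun_apply p z - a) \<in> epi (conjugate g)" using p by simp
  then show ?thesis
    unfolding mem_epi_conjugate_iff subdiff_iff_epi[of g, OF z] by (fastforce simp: blinfun.diff_right)
qed

section \<open>The bidual embedding and inversion of the subdifferential\<close>

lemma bidual_embed_apply [simp]: "blinfun_apply (bidual_embed z) p = blinfun_apply p z"
  by (simp add: bidual_embed.rep_eq)

lemma norm_bidual_embed_le: "norm (bidual_embed z) \<le> norm z"
proof (rule norm_blinfun_bound)
  show "norm (blinfun_apply (bidual_embed z) p) \<le> norm z * norm p" for p
    using norm_blinfun[of p z] by (simp add: mult.commute)
qed simp

text \<open>Separating the single point \<open>(x - y, - norm (x - y))\<close> from the cone with
  \<open>L = 1\<close> produces a functional that detects \<open>x - y\<close>.\<close>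

lemma inj_bidual_embed: "inj (bidual_embed :: 'a::real_normed_vector \<Rightarrow> _)"
proof (rule injI)
  fix x y :: 'a assume eq: "bidual_embed x = bidual_embed y"
  obtain \<xi> where "blinfun_apply \<xi> (x - y) \<le> - norm (x - y)"
    by (rule convex_above_cone_separation[of "{(x - y, - norm (x - y))}" 1]) auto
  moreover have "blinfun_apply \<xi> x = blinfun_apply \<xi> y" using eq by (metis bidual_embed_apply)
  ultimately show "x = y" by (simp add: blinfun.diff_right)
qed

lemma of_bidual_embed [simp]: "of_bidual (bidual_embed z) = z"
  by (simp add: of_bidual_def inv_f_f[OF inj_bidual_embed])

lemma bidual_embed_in_subdiff_conjugate_iff:
  assumes g: "g \<in> Gamma0"
  shows "bidual_embed z \<in> subdiff (conjugate g) p \<longleftrightarrow> p \<in> subdiff g z"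
proof
  note epi = Gamma0_epi[OF g]
  assume p: "p \<in> subdiff g z"
  then obtain a where a: "g z = ereal a" using subdiff_finite epi(3,4) by metis
  show "bidual_embed z \<in> subdiff (conjugate g) p"
    unfolding subdiff_iff_epi[of "conjugate g", OF conjugate_eq_on_subdiff[OF a p]] mem_epi_conjugate_iff
    using a by (auto simp: blinfun.diff_left)
next
  note epi = Gamma0_epi[OF g]
  assume z: "bidual_embed z \<in> subdiff (conjugate g) p"
  \<comment> \<open>If \<open>conjugate g\<close> were identically infinite, its
    \<open>subdiff\<close> would contain every functional. This is excluded because the
    Fenchel--Moreau bound would then hold vacuously at every height.\<close>
  have "epi (conjugate g) \<noteq> {}"
  proof
    assume "epi (conjugate g) = {}"
    then have "(z, t) \<in> epi g" for t by (intro biconjugate_ge[OF g]) (auto simp del: mem_epi)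
    then have "g z \<le> ereal t" for t by simp
    then have "g z = -\<infinity>" by (rule ereal_bot)
    then show False using epi(3) by simp
  qed
  then obtain b where b: "conjugate g p = ereal b"
    using subdiff_finite[OF z] epi_conjugate(3)[OF epi(4)] by metis
  have "(z, blinfun_apply p z - b) \<in> epi g"
    using z unfolding subdiff_iff_epi[of "conjugate g", OF b]
    by (intro biconjugate_ge[OF g]) (fastforce simp: blinfun.diff_left)
  then obtain a where a: "g z = ereal a" "a \<le> blinfun_apply p z - b"
    using epi_finiteE epi(3) by metis
  then show "p \<in> subdiff g z" using b by (intro subdiff_if_conjugate_le) auto
qed

text \<open>A common subgradient makes \<open>f\<close> affine on the segment from \<open>y\<close>
  to \<open>z\<close> and is a subgradient along all of it. The segment is thus a convex part of the
  domain of the subdifferential on which strict convexity fails at the midpoint.\<close>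

lemma legendre_subdiff_unique:
  assumes f: "legendre f" and p: "p \<in> subdiff f y" "p \<in> subdiff f z"
  shows "y = z"
proof (rule ccontr)
  assume ne: "y \<noteq> z"
  have "f \<in> Gamma0" using f by (simp add: legendre_def)
  note epi = Gamma0_epi[OF this]
  obtain a where a: "f y = ereal a" using subdiff_finite[OF p(1) epi(3,4)] .
  obtain b where b: "f z = ereal b" using subdiff_finite[OF p(2) epi(3,4)] .
  have sub: "a + blinfun_apply p (w - y) \<le> r" "b + blinfun_apply p (w - z) \<le> r" if "(w, r) \<in> epi f" for w r
    using p that by (simp_all add: subdiff_iff_epi[of f, OF a] subdiff_iff_epi[of f, OF b])
  have ab: "a - blinfun_apply p y = b - blinfun_apply p z"
    using sub(1)[of z b] sub(2)[of y a] a b by (simp add: blinfun.diff_right)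
  have on_seg: "p \<in> subdiff f w \<and> f w = ereal (a + blinfun_apply p (w - y))"
    if w: "w \<in> closed_segment y z" for w
  proof -
    obtain u where u: "0 \<le> u" "u \<le> 1" "w = (1 - u) *\<^sub>R y + u *\<^sub>R z" using w by (auto simp: in_segment)
    have "(w, (1 - u) * a + u * b) \<in> epi f"
      unfolding u(3) using u a b by (intro epi_convex_combination[OF epi(1)]) auto
    moreover have b_eq: "b = a + blinfun_apply p z - blinfun_apply p y" using ab by simp
    have "(1 - u) * a + u * b = a + blinfun_apply p (w - y)"
      by (simp add: u(3) b_eq blinfun.diff_right blinfun.add_right blinfun.scaleR_right algebra_simps)
    ultimately have mem: "(w, a + blinfun_apply p (w - y)) \<in> epi f" by simp
    then obtain c where c: "f w = ereal c" "c \<le> a + blinfun_apply p (w - y)"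
      using epi_finiteE epi(3) by metis
    moreover have "a + blinfun_apply p (w - y) \<le> c" using sub(1)[of w c] c(1) by simp
    ultimately have fw: "f w = ereal (a + blinfun_apply p (w - y))" by simp
    have "p \<in> subdiff f w"
      unfolding subdiff_iff_epi[of f, OF fw] using sub(1) by (auto simp: blinfun.diff_right)
    then show ?thesis using fw by simp
  qed
  have "closed_segment y z \<subseteq> op_dom (subdiff f)" using on_seg by (auto simp: op_dom_def)
  then have "strictly_convex_fun_on (closed_segment y z) f"
    using f convex_closed_segment by (simp add: legendre_def essentially_strictly_convex_def)
  then have "\<forall>t. 0 < t \<longrightarrow> t < 1 \<longrightarrow> f ((1 - t) *\<^sub>R y + t *\<^sub>R z) < ereal (1 - t) * f y + ereal t * f z"
    using ne unfolding strictly_convex_fun_on_def by auto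
  from this[rule_format, of "1/2"]
  have "f ((1 - 1/2) *\<^sub>R y + (1/2) *\<^sub>R z) < ereal (1 - 1/2) * f y + ereal (1/2) * f z" by simp
  moreover have "(1 - 1/2) *\<^sub>R y + (1/2) *\<^sub>R z \<in> closed_segment y z"
    unfolding in_segment by (intro exI[of _ "1/2"]) auto
  ultimately show False
    using on_seg ab a b by (simp add: blinfun.diff_right blinfun.add_right blinfun.scaleR_right)
qed

lemma legendre_subdiff_grad:
  fixes f :: "'a::banach \<Rightarrow> ereal"
  assumes f: "legendre f" and p: "p \<in> subdiff f z"
  shows "z \<in> interior (eff_dom f)" "subdiff f z = {p}" "grad f z = p"
proof -
  have "f \<in> Gamma0" using f by (simp add: legendre_def)
  note epi = Gamma0_epi[OF this]
  obtain a where a: "f z = ereal a" using subdiff_finite[OF p epi(3,4)] .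
  have dom: "z \<in> op_dom (subdiff f)" using p by (auto simp: op_dom_def)
  then show sv: "subdiff f z = {p}"
    using f p unfolding legendre_def essentially_smooth_def single_valued_on_dom_def by blast
  obtain \<rho> where "\<rho> > 0" "bounded (\<Union>w\<in>ball z \<rho>. subdiff f w)"
    using f dom unfolding legendre_def essentially_smooth_def locally_bounded_on_dom_def by blast
  then show int: "z \<in> interior (eff_dom f)"
    using locally_bounded_subdiff_interior[OF epi(1-3) a] sv by blast
  show "grad f z = p"
    by (rule grad_eq[OF unique_subgradient_has_gateaux_gradient[OF epi(1-3) int sv]])
qed

text \<open>The two halves of essential strict convexity dualize: uniqueness of the point with
  subgradient \<open>p\<close> makes the subdifferential of \<open>conjugate f\<close> at
  \<open>p\<close> a singleton, and local boundedness of the inverse passes to it because the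
  embedding does not increase norms. Reflexivity represents every element of the bidual.\<close>

lemma legendre_subdiff_grad_conjugate:
  fixes f :: "'a::banach \<Rightarrow> ereal"
  assumes refl: "reflexive_space TYPE('a)" and f: "legendre f" and p: "p \<in> subdiff f z"
  shows "p \<in> interior (eff_dom (conjugate f))" "grad (conjugate f) p = bidual_embed z"
proof -
  have \<Gamma>: "f \<in> Gamma0" using f by (simp add: legendre_def)
  note epi = Gamma0_epi[OF this]
  have onto: "\<exists>w. \<xi> = bidual_embed w" for \<xi> :: "('a \<Rightarrow>\<^sub>L real) \<Rightarrow>\<^sub>L real"
    using refl unfolding reflexive_space_def surj_def by blast
  obtain a where a: "f z = ereal a" using subdiff_finite[OF p epi(3,4)] .
  have sv: "subdiff (conjugate f) p = {bidual_embed z}"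
  proof
    show "{bidual_embed z} \<subseteq> subdiff (conjugate f) p"
      using bidual_embed_in_subdiff_conjugate_iff[OF \<Gamma>] p by blast
    show "subdiff (conjugate f) p \<subseteq> {bidual_embed z}"
      using bidual_embed_in_subdiff_conjugate_iff[OF \<Gamma>] onto legendre_subdiff_unique[OF f p]
      by (metis singletonI subsetI)
  qed
  have "p \<in> op_dom (op_inverse (subdiff f))" using p by (auto simp: op_dom_def op_inverse_def)
  then obtain \<rho> where \<rho>: "\<rho> > 0" "bounded (\<Union>q\<in>ball p \<rho>. op_inverse (subdiff f) q)"
    using f unfolding legendre_def essentially_strictly_convex_def locally_bounded_on_dom_def by blast
  then obtain M where M: "\<And>q w. q \<in> ball p \<rho> \<Longrightarrow> q \<in> subdiff f w \<Longrightarrow> norm w \<le> M"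
    unfolding bounded_iff op_inverse_def by blast
  have "norm \<xi> \<le> M" if "q \<in> ball p \<rho>" "\<xi> \<in> subdiff (conjugate f) q" for \<xi> q
  proof -
    obtain w where w: "\<xi> = bidual_embed w" using onto by blast
    then have "q \<in> subdiff f w" using that(2) bidual_embed_in_subdiff_conjugate_iff[OF \<Gamma>] by simp
    then show ?thesis using M[OF that(1)] norm_bidual_embed_le[of w] w by fastforce
  qed
  then have "bounded (\<Union>q\<in>ball p \<rho>. subdiff (conjugate f) q)"
    unfolding bounded_iff by blast
  note conj = epi_conjugate(1,2)[of f] epi_conjugate(3)[OF epi(4)]
  show int: "p \<in> interior (eff_dom (conjugate f))"
    by (rule locally_bounded_subdiff_interior[OF conj conjugate_eq_on_subdiff[OF a p] _ \<rho>(1)]) (use sv in simp, fact)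
  show "grad (conjugate f) p = bidual_embed z"
    by (rule grad_eq[OF unique_subgradient_has_gateaux_gradient[OF conj int sv]])
qed

section \<open>Exactness of the infimal convolution\<close>

lemma subspace_closure:
  fixes S :: "'a::real_normed_vector set"
  assumes "subspace S"
  shows "subspace (closure S)"
proof (rule subspaceI)
  show "0 \<in> closure S" using subspace_0[OF assms] closure_subset by blast
  fix x y assume "x \<in> closure S" "y \<in> closure S"
  then obtain u v where u: "\<And>n. u n \<in> S" "u \<longlonglongrightarrow> x" and v: "\<And>n. v n \<in> S" "v \<longlonglongrightarrow> y"
    unfolding closure_sequential by metis
  show "x + y \<in> closure S"
    unfolding closure_sequential
    by (intro exI[of _ "\<lambda>n. u n + v n"]) (auto intro: subspace_add[OF assms] u v tendsto_add)
next
  fix x :: 'a and c :: real assume "x \<in> closure S"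
  then obtain u where u: "\<And>n. u n \<in> S" "u \<longlonglongrightarrow> x"
    unfolding closure_sequential by metis
  show "c *\<^sub>R x \<in> closure S"
    unfolding closure_sequential
    by (intro exI[of _ "\<lambda>n. c *\<^sub>R u n"]) (auto intro: subspace_scale[OF assms] u tendsto_scaleR)
qed

text \<open>The quantitative form of the condition: near 0 in \<open>S\<close>, every vector splits
  as a difference of domain points with one bound \<open>n\<close> on the point and both function
  values. The cone identity behind \<open>sri\<close> is exactly absorption.\<close>

lemma sri_open_difference:
  fixes F G :: "'v::banach \<Rightarrow> ereal"
  assumes F: "convex (epi F)" "closed (epi F)" and G: "convex (epi G)" "closed (epi G)"
    and sri: "0 \<in> sri (minkowski_diff (eff_dom F) (eff_dom G))"
  obtains S n \<rho> where "subspace S" "\<And>q w s t. (q + w, s) \<in> epi F \<Longrightarrow> (q, t) \<in> epi G \<Longrightarrow> w \<in> S" "\<rho> > 0"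
    "\<And>w. w \<in> S \<Longrightarrow> norm w < \<rho> \<Longrightarrow> \<exists>q. norm q \<le> n \<and> (q + w, n) \<in> epi F \<and> (q, n) \<in> epi G"
proof -
  define C where "C = minkowski_diff (eff_dom F) (eff_dom G)"
  define S where "S = closure (span C)"
  have cone: "(\<Union>l\<in>{0<..}. (\<lambda>c. l *\<^sub>R c) ` C) = S"
    using sri unfolding sri_def C_def[symmetric] S_def by simp
  have S: "subspace S" "closed S" unfolding S_def by (auto intro: subspace_closure)
  have CS: "C \<subseteq> S" unfolding S_def by (meson closure_subset order_trans span_superset)
  have diff_S: "w \<in> S" if "(q + w, s) \<in> epi F" "(q, t) \<in> epi G" for q w s t
  proof -
    have "q + w \<in> eff_dom F" "q \<in> eff_dom G" using that by (auto simp: eff_dom_def)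
    then have "q + w - q \<in> C" unfolding C_def minkowski_diff_def by blast
    then show ?thesis using CS by auto
  qed
  \<comment> \<open>The splitting point \<open>q\<close> is kept as first coordinate, so that the
    sets are closed before projection; the norm bound is the boundedness that the projection lemma
    requires.\<close>
  define D where "D n = {(q, w). norm q \<le> real n \<and> (q + w, real n) \<in> epi F \<and> (q, real n) \<in> epi G}" for n
  have D_eq: "D n = (cball 0 (real n) \<times> UNIV) \<inter> (\<lambda>(q, w). (q + w, real n)) -` epi F
      \<inter> (\<lambda>(q, w). (q, real n)) -` epi G" for n
    by (auto simp: D_def)
  have D_closed: "closed (D n)" for n
    unfolding D_eq
    by (intro closed_Int closed_Times closed_vimage F G)
      (auto simp: case_prod_beta intro!: continuous_intros)
  have D_convex: "convex (D n)" for n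
  proof (rule convexI)
    fix a b :: "'v \<times> 'v" and u v :: real
    assume ab: "a \<in> D n" "b \<in> D n" and u: "0 \<le> u" "0 \<le> v" "u + v = 1"
    obtain q1 w1 q2 w2 where eq: "a = (q1, w1)" "b = (q2, w2)" by (cases a, cases b)
    have n: "u * real n + v * real n = real n" using u(3) by (simp flip: distrib_right)
    have "norm (u *\<^sub>R q1 + v *\<^sub>R q2) \<le> u * norm q1 + v * norm q2"
      using u norm_triangle_ineq[of "u *\<^sub>R q1" "v *\<^sub>R q2"] by simp
    also have "\<dots> \<le> u * real n + v * real n"
      using ab eq u by (intro add_mono mult_left_mono) (auto simp: D_def)
    finally have 1: "norm (u *\<^sub>R q1 + v *\<^sub>R q2) \<le> real n" using n by simp
    have 2: "(u *\<^sub>R (q1 + w1) + v *\<^sub>R (q2 + w2), real n) \<in> epi F"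
      using epi_convex_combination[OF F(1) _ _ u, of "q1 + w1" "real n" "q2 + w2" "real n"] ab eq n
      by (simp add: D_def)
    have 3: "(u *\<^sub>R q1 + v *\<^sub>R q2, real n) \<in> epi G"
      using epi_convex_combination[OF G(1) _ _ u, of q1 "real n" q2 "real n"] ab eq n
      by (simp add: D_def)
    have "u *\<^sub>R (q1 + w1) + v *\<^sub>R (q2 + w2) = (u *\<^sub>R q1 + v *\<^sub>R q2) + (u *\<^sub>R w1 + v *\<^sub>R w2)"
      by (simp add: algebra_simps)
    then show "u *\<^sub>R a + v *\<^sub>R b \<in> D n" using 1 2 3 by (simp add: D_def eq)
  qed
  have D_bounded: "bounded (fst ` D n)" for n
    by (rule bounded_subset[OF bounded_cball[of 0 "real n"]]) (auto simp: D_def)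
  have D_mono: "D m \<subseteq> D n" if "m \<le> n" for m n
    using that by (auto simp: D_def intro: order_trans)
  have D_S: "snd ` D n \<subseteq> S" for n using diff_S by (auto simp: D_def simp del: mem_epi)
  have D_absorb: "\<exists>n. \<exists>t>0. t *\<^sub>R w \<in> snd ` D n" if w: "w \<in> S" for w
  proof -
    obtain l c where l: "l > 0" "c \<in> C" "w = l *\<^sub>R c" using w cone by blast
    obtain a b where ab: "c = a - b" "F a < \<infinity>" "G b < \<infinity>"
      using l(2) by (auto simp: C_def minkowski_diff_def eff_dom_def)
    obtain i j :: nat where ij: "F a < ereal (real i)" "G b < ereal (real j)"
      using ab(2,3) by (metis less_PInf_Ex_of_nat less_irrefl)
    obtain k :: nat where k: "norm b \<le> real k" using real_arch_simple by blast
    define n where "n = max (max i j) k"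
    have le: "ereal (real i) \<le> ereal (real n)" "ereal (real j) \<le> ereal (real n)" "real k \<le> real n"
      by (simp_all add: n_def)
    have "(b, c) \<in> D n"
      unfolding D_def
      using ij k ab(1) le order_trans[OF less_imp_le le(1)] order_trans[OF less_imp_le le(2)] by simp
    then have "c \<in> snd ` D n" by force
    moreover have "(1 / l) *\<^sub>R w = c" using l by simp
    ultimately show ?thesis using l(1) by (intro exI[of _ n] exI[of _ "1 / l"]) auto
  qed
  obtain n \<rho> where \<rho>: "\<rho> > 0" "ball 0 \<rho> \<inter> S \<subseteq> snd ` D n"
    by (rule convex_closed_projection_absorbing[OF D_convex D_closed D_bounded D_mono S D_S D_absorb])
  show thesis
  proof (rule that[of S \<rho> "real n"])
    show "\<exists>q. norm q \<le> real n \<and> (q + w, real n) \<in> epi F \<and> (q, real n) \<in> epi G"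
      if "w \<in> S" "norm w < \<rho>" for w
      using \<rho>(2) that by (force simp: D_def)
  qed (use S \<rho> diff_S in \<open>auto simp del: mem_epi\<close>)
qed

text \<open>
  Attouch--Brezis: the value function \<open>w \<mapsto> inf\<^sub>q f\<^sup>*(q + w) + \<phi>\<^sup>*(q) - q x\<close> is calm at \<open>0\<close>;
  a subgradient there is a point \<open>z\<close> of the bidual at which the infimal convolution is attained.
\<close>

lemma attouch_brezis_exact:
  fixes f \<phi> :: "'a::real_normed_vector \<Rightarrow> ereal"
  assumes refl: "reflexive_space TYPE('a)" and f: "f \<in> Gamma0" and \<phi>: "\<phi> \<in> Gamma0"
    and sri: "0 \<in> sri (minkowski_diff (eff_dom (conjugate f)) (eff_dom (conjugate \<phi>)))"
    and \<kappa>: "\<And>q s t. (q, s) \<in> epi (conjugate f) \<Longrightarrow> (q, t) \<in> epi (conjugate \<phi>) \<Longrightarrow>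
      blinfun_apply q x - s - t \<le> \<kappa>"
  obtains z a b where "(z, a) \<in> epi f" "(x - z, b) \<in> epi \<phi>" "a + b \<le> \<kappa>"
proof -
  note epi_f = epi_conjugate(1,2)[of f] and epi_\<phi> = epi_conjugate(1,2)[of \<phi>]
  obtain S n \<rho> where S: "subspace S"
      "\<And>q w s t. (q + w, s) \<in> epi (conjugate f) \<Longrightarrow> (q, t) \<in> epi (conjugate \<phi>) \<Longrightarrow> w \<in> S"
    and \<rho>: "\<rho> > 0" "\<And>w. w \<in> S \<Longrightarrow> norm w < \<rho> \<Longrightarrow>
      \<exists>q. norm q \<le> n \<and> (q + w, n) \<in> epi (conjugate f) \<and> (q, n) \<in> epi (conjugate \<phi>)"
    by (rule sri_open_difference[OF epi_f epi_\<phi> sri]) (rule that)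
  \<comment> \<open>Points above the value function shifted up by \<open>\<kappa>\<close>; the
    assumption on \<open>\<kappa>\<close> says that at \<open>w = 0\<close> all heights are
    nonnegative.\<close>
  define H where "H = {(w, s + t - blinfun_apply q x + \<kappa>) | w s t q.
      (q + w, s) \<in> epi (conjugate f) \<and> (q, t) \<in> epi (conjugate \<phi>)}"
  have HI: "(w, s + t - blinfun_apply q x + \<kappa>) \<in> H"
    if "(q + w, s) \<in> epi (conjugate f)" "(q, t) \<in> epi (conjugate \<phi>)" for w s t q
    using that unfolding H_def by blast
  have H_convex: "convex H"
  proof (rule convexI)
    fix a b :: "('a \<Rightarrow>\<^sub>L real) \<times> real" and u v :: real
    assume ab: "a \<in> H" "b \<in> H" and u: "0 \<le> u" "0 \<le> v" "u + v = 1"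
    obtain w1 s1 t1 q1 where 1: "a = (w1, s1 + t1 - blinfun_apply q1 x + \<kappa>)"
        "(q1 + w1, s1) \<in> epi (conjugate f)" "(q1, t1) \<in> epi (conjugate \<phi>)"
      using ab(1) unfolding H_def by blast
    obtain w2 s2 t2 q2 where 2: "b = (w2, s2 + t2 - blinfun_apply q2 x + \<kappa>)"
        "(q2 + w2, s2) \<in> epi (conjugate f)" "(q2, t2) \<in> epi (conjugate \<phi>)"
      using ab(2) unfolding H_def by blast
    have v: "v = 1 - u" using u by simp
    have "u *\<^sub>R (q1 + w1) + v *\<^sub>R (q2 + w2) = (u *\<^sub>R q1 + v *\<^sub>R q2) + (u *\<^sub>R w1 + v *\<^sub>R w2)"
      by (simp add: algebra_simps)
    then have "(u *\<^sub>R w1 + v *\<^sub>R w2, (u * s1 + v * s2) + (u * t1 + v * t2)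
        - blinfun_apply (u *\<^sub>R q1 + v *\<^sub>R q2) x + \<kappa>) \<in> H"
      using epi_convex_combination[OF epi_f(1) 1(2) 2(2) u]
        epi_convex_combination[OF epi_\<phi>(1) 1(3) 2(3) u] by (intro HI) (simp_all del: mem_epi)
    moreover have "u *\<^sub>R a + v *\<^sub>R b = (u *\<^sub>R w1 + v *\<^sub>R w2, (u * s1 + v * s2) + (u * t1 + v * t2)
        - blinfun_apply (u *\<^sub>R q1 + v *\<^sub>R q2) x + \<kappa>)"
      unfolding blinfun.add_left blinfun.scaleR_left by (simp add: 1(1) 2(1) v algebra_simps)
    ultimately show "u *\<^sub>R a + v *\<^sub>R b \<in> H" by simp
  qed
  have H0: "r \<ge> 0" if r: "(0, r) \<in> H" for r
  proof -
    obtain s t q where "r = s + t - blinfun_apply q x + \<kappa>"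
        "(q, s) \<in> epi (conjugate f)" "(q, t) \<in> epi (conjugate \<phi>)"
      using r unfolding H_def by auto
    then show ?thesis using \<kappa>[of q s t] by simp
  qed
  have H_S: "w \<in> S" if "(w, r) \<in> H" for w r using that S(2) unfolding H_def by blast
  define B where "B = \<bar>2 * n + n * norm x + \<kappa>\<bar>"
  have H_bound: "\<exists>r\<le>B. (w, r) \<in> H" if w: "w \<in> S" "norm w < \<rho>" for w
  proof -
    obtain q where q: "norm q \<le> n" "(q + w, n) \<in> epi (conjugate f)" "(q, n) \<in> epi (conjugate \<phi>)"
      using \<rho>(2)[OF w] by blast
    have "- blinfun_apply q x \<le> norm q * norm x" using norm_blinfun[of q x] by simp
    also have "\<dots> \<le> n * norm x" using q(1) by (intro mult_right_mono) auto
    finally have "n + n - blinfun_apply q x + \<kappa> \<le> B" by (simp add: B_def)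
    then show ?thesis using HI[OF q(2,3)] by blast
  qed
  have calm: "- (2 * B / \<rho>) * norm v \<le> r" if vr: "(v, r) \<in> H" for v r
  proof (cases "v = 0")
    case True
    then show ?thesis using H0 vr by simp
  next
    case False
    \<comment> \<open>The opposite point \<open>(- k) *\<^sub>R v\<close> has norm
      \<open>\<rho> / 2\<close> and lies in \<open>S\<close>, so its height can be taken at most
      \<open>B\<close>. Convexity at 0 turns this upper bound into a lower bound at
      \<open>v\<close>.\<close>
    define k where "k = \<rho> / (2 * norm v)"
    have k: "k > 0" using False \<rho>(1) by (simp add: k_def)
    have "norm ((- k) *\<^sub>R v) < \<rho>" using False \<rho>(1) by (simp add: k_def)
    moreover have "(- k) *\<^sub>R v \<in> S" using H_S[OF vr] S(1) by (intro subspace_scale)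
    ultimately obtain R where R: "R \<le> B" "((- k) *\<^sub>R v, R) \<in> H" using H_bound by metis
    have "(k / (1 + k)) *\<^sub>R (v, r) + (1 / (1 + k)) *\<^sub>R ((- k) *\<^sub>R v, R) \<in> H"
      using k by (intro convexD[OF H_convex vr R(2)]) (auto simp: add_divide_distrib[symmetric])
    then have "0 \<le> k / (1 + k) * r + 1 / (1 + k) * R" by (intro H0) simp
    then have "0 \<le> (k * r + R) / (1 + k)" by (simp add: add_divide_distrib)
    then have "0 \<le> k * r + B" using k R(1) by (simp add: zero_le_divide_iff)
    then have "- B / k \<le> r" using k by (simp add: field_simps)
    moreover have "- B / k = - (2 * B / \<rho>) * norm v" by (simp add: k_def)
    ultimately show ?thesis by simp
  qed
  have "H \<noteq> {}" using H_bound[of 0] S(1) \<rho>(1) subspace_0 by fastforce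
  moreover have "2 * B / \<rho> \<ge> 0" using \<rho>(1) by (simp add: B_def)
  ultimately obtain \<xi> where \<xi>: "\<And>v r. (v, r) \<in> H \<Longrightarrow> blinfun_apply \<xi> v \<le> r"
    using convex_above_cone_separation[OF H_convex _ calm] by metis
  obtain z where z: "\<xi> = bidual_embed z"
    using refl unfolding reflexive_space_def surj_def by blast
  \<comment> \<open>Writing \<open>w = p - q\<close> decouples the inequality: one side involves
    only \<open>conjugate f\<close>, the other only \<open>conjugate \<phi>\<close>, so
    biconjugation applies to each in turn.\<close>
  have key: "blinfun_apply p z - s \<le> \<kappa> + t - blinfun_apply q (x - z)"
    if "(p, s) \<in> epi (conjugate f)" "(q, t) \<in> epi (conjugate \<phi>)" for p s q t
    using \<xi>[OF HI[of q "p - q" s t]] that by (simp add: z blinfun.diff_left blinfun.diff_right)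
  \<comment> \<open>A fixed point of the domain of \<open>conjugate \<phi>\<close> shows that
    \<open>f z\<close> is finite, after which its exact value \<open>a\<close> can be used for all
    \<open>q\<close>.\<close>
  obtain q0 t0 where q0: "(q0, t0) \<in> epi (conjugate \<phi>)"
    using \<rho>(2)[of 0] S(1) \<rho>(1) subspace_0 by auto
  have "(z, \<kappa> + t0 - blinfun_apply q0 (x - z)) \<in> epi f"
    by (rule biconjugate_ge[OF f]) (use key q0 in blast)
  then obtain a where a: "f z = ereal a" using epi_finiteE Gamma0_epi(3)[OF f] by metis
  have "(x - z, \<kappa> - a) \<in> epi \<phi>"
  proof (rule biconjugate_ge[OF \<phi>])
    fix q t assume q: "(q, t) \<in> epi (conjugate \<phi>)"
    have "(z, \<kappa> + t - blinfun_apply q (x - z)) \<in> epi f"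
      by (rule biconjugate_ge[OF f]) (use key q in blast)
    then show "blinfun_apply q (x - z) - t \<le> \<kappa> - a" using a by simp
  qed
  then show thesis using a by (intro that[of z a "\<kappa> - a"]) auto
qed

lemma is_minimizer_INF: "is_minimizer h y \<Longrightarrow> (INF z. h z) = h y"
  by (intro antisym INF_lower INF_greatest) (auto simp: is_minimizer_def)

theorem theorem3p1:
  fixes f \<phi> :: "'a::banach \<Rightarrow> ereal" and x :: 'a
  assumes "reflexive_space TYPE('a)"
    and "f \<in> Gamma0" and "legendre f"
    and "\<phi> \<in> Gamma0"
    and "0 \<in> sri (minkowski_diff (eff_dom (conjugate f)) (eff_dom (conjugate \<phi>)))"
    and "x \<in> interior (eff_dom f) \<inter> interior (minkowski_sum (eff_dom f) (eff_dom \<phi>))"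
  shows "f x = inf_conv \<phi> f x + bregman_env (conjugate \<phi>) (conjugate f) (grad f x)
    \<and> x = aprox f \<phi> x
            + of_bidual (grad (conjugate f) (bprox (conjugate f) (conjugate \<phi>) (grad f x)))
    \<and> ereal (blinfun_apply (bprox (conjugate f) (conjugate \<phi>) (grad f x)) (aprox f \<phi> x))
          = \<phi> (aprox f \<phi> x) + conjugate \<phi> (bprox (conjugate f) (conjugate \<phi>) (grad f x))
    \<and> ereal (blinfun_apply (grad f (x - aprox f \<phi> x)) (aprox f \<phi> x))
          = \<phi> (aprox f \<phi> x) + conjugate \<phi> (grad f (x - aprox f \<phi> x))"
proof -
  note refl = assms(1) and f = assms(2) and leg = assms(3) and \<phi> = assms(4) and sri = assms(5)
  note ef = Gamma0_epi[OF f] and e\<phi> = Gamma0_epi[OF \<phi>]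
  note efc = epi_conjugate(3)[OF ef(4)] and e\<phi>c = epi_conjugate(3)[OF e\<phi>(4)]
  have FY_f: "blinfun_apply q w - r \<le> s" if "(w, r) \<in> epi f" "(q, s) \<in> epi (conjugate f)" for q w r s
    using that by (simp add: mem_epi_conjugate_iff del: mem_epi)
  have FY_\<phi>: "blinfun_apply q w - r \<le> s" if "(w, r) \<in> epi \<phi>" "(q, s) \<in> epi (conjugate \<phi>)" for q w r s
    using that by (simp add: mem_epi_conjugate_iff del: mem_epi)

  \<comment> \<open>The closed convex function \<open>k\<close> and its domain\<close>
  define h where "h q = conjugate f q + conjugate \<phi> q" for q
  \<comment> \<open>The conjugate of \<open>h\<close> lives on the bidual; composing with the
    embedding pulls it back to the space of \<open>x\<close> and keeps it closed and convex.\<close>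
  define k where "k w = conjugate h (bidual_embed w)" for w
  have mem_h: "(q, r) \<in> epi h \<longleftrightarrow>
      (\<exists>s t. (q, s) \<in> epi (conjugate f) \<and> (q, t) \<in> epi (conjugate \<phi>) \<and> s + t \<le> r)" for q r
  proof
    assume "(q, r) \<in> epi h"
    then have "conjugate f q + conjugate \<phi> q \<le> ereal r" by (simp add: h_def)
    moreover from this obtain s t where "conjugate f q = ereal s" "conjugate \<phi> q = ereal t"
      using efc[of q] e\<phi>c[of q] by (cases "conjugate f q"; cases "conjugate \<phi> q") auto
    ultimately have "(q, s) \<in> epi (conjugate f) \<and> (q, t) \<in> epi (conjugate \<phi>) \<and> s + t \<le> r"
      by simp
    then show "\<exists>s t. (q, s) \<in> epi (conjugate f) \<and> (q, t) \<in> epi (conjugate \<phi>) \<and> s + t \<le> r"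
      by blast
  next
    assume "\<exists>s t. (q, s) \<in> epi (conjugate f) \<and> (q, t) \<in> epi (conjugate \<phi>) \<and> s + t \<le> r"
    then obtain s t where st: "conjugate f q \<le> ereal s" "conjugate \<phi> q \<le> ereal t" "s + t \<le> r" by auto
    have "h q \<le> ereal (s + t)" using add_mono[OF st(1,2)] by (simp add: h_def)
    also have "\<dots> \<le> ereal r" using st(3) by simp
    finally show "(q, r) \<in> epi h" by simp
  qed
  have mem_k: "(w, r) \<in> epi k \<longleftrightarrow> (\<forall>q s t. (q, s) \<in> epi (conjugate f) \<longrightarrow>
      (q, t) \<in> epi (conjugate \<phi>) \<longrightarrow> blinfun_apply q w - s - t \<le> r)" for w r
  proof -
    have "(w, r) \<in> epi k \<longleftrightarrow> (bidual_embed w, r) \<in> epi (conjugate h)" by (simp add: k_def)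
    also have "\<dots> \<longleftrightarrow> (\<forall>q c. (q, c) \<in> epi h \<longrightarrow> blinfun_apply q w - c \<le> r)"
      unfolding mem_epi_conjugate_iff by simp
    also have "\<dots> \<longleftrightarrow> (\<forall>q s t. (q, s) \<in> epi (conjugate f) \<longrightarrow>
      (q, t) \<in> epi (conjugate \<phi>) \<longrightarrow> blinfun_apply q w - s - t \<le> r)"
      unfolding mem_h
    proof safe
      fix q s t
      assume "\<forall>q c. (\<exists>s t. (q, s) \<in> epi (conjugate f) \<and> (q, t) \<in> epi (conjugate \<phi>) \<and> s + t \<le> c) \<longrightarrow>
        blinfun_apply q w - c \<le> r" "(q, s) \<in> epi (conjugate f)" "(q, t) \<in> epi (conjugate \<phi>)"
      then have "blinfun_apply q w - (s + t) \<le> r" by blast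
      then show "blinfun_apply q w - s - t \<le> r" by simp
    next
      fix q c s t
      assume "\<forall>q s t. (q, s) \<in> epi (conjugate f) \<longrightarrow> (q, t) \<in> epi (conjugate \<phi>) \<longrightarrow>
        blinfun_apply q w - s - t \<le> r" "(q, s) \<in> epi (conjugate f)" "(q, t) \<in> epi (conjugate \<phi>)" "s + t \<le> c"
      then have "blinfun_apply q w - s - t \<le> r" by blast
      then show "blinfun_apply q w - c \<le> r" using \<open>s + t \<le> c\<close> by simp
    qed
    finally show ?thesis .
  qed
  have bl_embed: "bounded_linear (bidual_embed :: 'a \<Rightarrow> _)"
    by (rule bounded_linear_intro[of _ 1])
      (auto intro!: blinfun_eqI simp: blinfun.add_left blinfun.scaleR_left blinfun.add_right
        blinfun.scaleR_right norm_bidual_embed_le)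
  have bl: "bounded_linear (\<lambda>(w :: 'a, r :: real). (bidual_embed w, r))"
    unfolding case_prod_beta'
    by (intro bounded_linear_Pair bounded_linear_compose[OF bl_embed] bounded_linear_fst bounded_linear_snd)
  have epi_k_eq: "epi k = (\<lambda>(w, r). (bidual_embed w, r)) -` epi (conjugate h)"
    by (auto simp: k_def)
  have ek: "convex (epi k)" "closed (epi k)"
    unfolding epi_k_eq
    using epi_conjugate(1,2)[of h] bl
    by (auto intro: convex_linear_vimage closed_vimage linear_continuous_on bounded_linear.linear)
  \<comment> \<open>Adding the two Fenchel--Young inequalities: \<open>k\<close> lies below the
    infimal convolution, so its domain contains the Minkowski sum around \<open>x\<close>.\<close>
  have k_sum: "(w + y, r + c) \<in> epi k" if "(w, r) \<in> epi f" "(y, c) \<in> epi \<phi>" for w r y c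
    unfolding mem_k
  proof (intro allI impI)
    fix q s t assume "(q, s) \<in> epi (conjugate f)" "(q, t) \<in> epi (conjugate \<phi>)"
    then show "blinfun_apply q (w + y) - s - t \<le> r + c"
      using FY_f[OF that(1), of q s] FY_\<phi>[OF that(2), of q t] by (simp add: blinfun.add_right)
  qed
  have "minkowski_sum (eff_dom f) (eff_dom \<phi>) \<subseteq> eff_dom k"
  proof
    fix v assume "v \<in> minkowski_sum (eff_dom f) (eff_dom \<phi>)"
    then obtain w y where v: "v = w + y" "f w < \<infinity>" "\<phi> y < \<infinity>"
      by (auto simp: minkowski_sum_def eff_dom_def)
    then obtain r c where "f w = ereal r" "\<phi> y = ereal c"
      using ef(3)[of w] e\<phi>(3)[of y] by (cases "f w"; cases "\<phi> y") auto
    then have "(v, r + c) \<in> epi k" unfolding v(1) by (intro k_sum) auto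
    then show "v \<in> eff_dom k" by (auto simp: eff_dom_def)
  qed
  then have x_int: "x \<in> interior (eff_dom k)" using assms(6) interior_mono by blast
  have "epi h \<noteq> {}"
  proof -
    obtain q where "conjugate f q < \<infinity>" "conjugate \<phi> q < \<infinity>"
      using sri by (auto simp: sri_def minkowski_diff_def eff_dom_def)
    then have "h q < \<infinity>" by (simp add: h_def)
    then show ?thesis by (auto simp: epi_eq_empty_iff eff_dom_def)
  qed
  then have "k x \<noteq> -\<infinity>" unfolding k_def by (rule epi_conjugate(3))
  moreover have "k x < \<infinity>" using x_int interior_subset by (auto simp: eff_dom_def)
  ultimately obtain \<kappa> where \<kappa>: "k x = ereal \<kappa>" by (cases "k x") auto

  \<comment> \<open>Exact splitting of \<open>x\<close> and the common subgradient\<close>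
  have "(x, \<kappa>) \<in> epi k" using \<kappa> by simp
  then have "blinfun_apply q x - s - t \<le> \<kappa>"
    if "(q, s) \<in> epi (conjugate f)" "(q, t) \<in> epi (conjugate \<phi>)" for q s t
    using that unfolding mem_k by blast
  then obtain z a' b' where z': "(z, a') \<in> epi f" "(x - z, b') \<in> epi \<phi>" "a' + b' \<le> \<kappa>"
    using attouch_brezis_exact[OF refl f \<phi> sri] by metis
  define y where "y = x - z"
  obtain a where a: "f z = ereal a" "a \<le> a'" using epi_finiteE[OF z'(1) ef(3)[of z]] .
  obtain b where b: "\<phi> y = ereal b" "b \<le> b'"
    unfolding y_def using epi_finiteE[OF z'(2) e\<phi>(3)[of "x - z"]] .
  have ab: "f z = ereal a" "\<phi> y = ereal b" "a + b \<le> \<kappa>" using a b z'(3) by auto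
  have \<kappa>_le: "\<kappa> \<le> r + c" if "(w, r) \<in> epi f" "(x - w, c) \<in> epi \<phi>" for w r c
    using k_sum[OF that] \<kappa> by simp
  have "\<kappa> \<le> a + b" using ab by (intro \<kappa>_le[of z]) (auto simp: y_def)
  then have \<kappa>_eq: "\<kappa> = a + b" using ab(3) by simp
  obtain p where p: "p \<in> subdiff k x" using interior_subdiff_nonempty[OF ek \<kappa> x_int] by blast
  have p_k: "\<kappa> + blinfun_apply p (w - x) \<le> r" if "(w, r) \<in> epi k" for w r
    using p that unfolding subdiff_iff_epi[of k, OF \<kappa>] by blast
  \<comment> \<open>Stated for any optimal splitting, because it is reused for a competing
    minimizer: its \<open>f\<close>-part also has the subgradient \<open>p\<close> and must coincide
    with \<open>z\<close>.\<close>
  have p_f: "p \<in> subdiff f w" if w: "f w = ereal r" "\<phi> (x - w) = ereal c" "r + c \<le> \<kappa>" for w r c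
    unfolding subdiff_iff_epi[of f, OF w(1)]
  proof (intro allI impI)
    fix v s assume "(v, s) \<in> epi f"
    then have "(v + (x - w), s + c) \<in> epi k" using w(2) by (intro k_sum) auto
    from p_k[OF this] show "r + blinfun_apply p (v - w) \<le> s" using w(3) by simp
  qed
  have pz: "p \<in> subdiff f z" using p_f ab by (simp add: y_def)
  have py: "p \<in> subdiff \<phi> y"
    unfolding subdiff_iff_epi[of \<phi>, OF ab(2)]
  proof (intro allI impI)
    fix v s assume "(v, s) \<in> epi \<phi>"
    then have "(z + v, a + s) \<in> epi k" using ab(1) by (intro k_sum) auto
    from p_k[OF this] show "b + blinfun_apply p (v - y) \<le> s"
      using \<kappa>_eq by (simp add: y_def algebra_simps)
  qed

  \<comment> \<open>Gradients at the pairs \<open>(z, p)\<close> and \<open>(x, u)\<close>\<close>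
  note grad_z = legendre_subdiff_grad[OF leg pz]
  note grad_p = legendre_subdiff_grad_conjugate[OF refl leg pz]
  have conj_p: "conjugate f p = ereal (blinfun_apply p z - a)" "conjugate \<phi> p = ereal (blinfun_apply p y - b)"
    using conjugate_eq_on_subdiff[of f, OF ab(1) pz] conjugate_eq_on_subdiff[of \<phi>, OF ab(2) py] by auto
  have "f x < \<infinity>" using assms(6) interior_subset by (auto simp: eff_dom_def)
  then obtain c where c: "f x = ereal c" using ef(3)[of x] by (cases "f x") auto
  obtain u where u: "u \<in> subdiff f x"
    using interior_subdiff_nonempty[OF ef(1,2) c] assms(6) by blast
  note grad_x = legendre_subdiff_grad[OF leg u]
  note grad_u = legendre_subdiff_grad_conjugate[OF refl leg u]
  note conj_u = conjugate_eq_on_subdiff[of f, OF c u]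
  \<comment> \<open>The gradient of \<open>conjugate f\<close> at \<open>u\<close> is the embedded
    \<open>x\<close>, and Fenchel--Young equality at \<open>(x, u)\<close> cancels all terms in
    \<open>u\<close>.\<close>
  have breg: "bregman (conjugate f) q u = conjugate f q - ereal (blinfun_apply q x - c)" for q
    using grad_u conj_u
    by (cases "conjugate f q") (simp_all add: bregman_def blinfun.diff_left)

  \<comment> \<open>The primal problem and its unique minimizer\<close>
  have min_a: "is_minimizer (\<lambda>y. \<phi> y + f (x - y)) y"
    unfolding is_minimizer_def
  proof
    fix v
    have "ereal \<kappa> \<le> \<phi> v + f (x - v)"
    proof (cases "\<phi> v = \<infinity> \<or> f (x - v) = \<infinity>")
      case True
      then show ?thesis by auto
    next
      case False
      then obtain r s where "\<phi> v = ereal r" "f (x - v) = ereal s"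
        using ef(3)[of "x - v"] e\<phi>(3)[of v] by (cases "\<phi> v"; cases "f (x - v)") auto
      then show ?thesis using \<kappa>_le[of "x - v" s r] by (simp add: add.commute)
    qed
    then show "\<phi> y + f (x - y) \<le> \<phi> v + f (x - v)" using ab \<kappa>_eq by (simp add: y_def add.commute)
  qed
  have val_a: "\<phi> y + f (x - y) = ereal \<kappa>" using ab \<kappa>_eq by (simp add: y_def add.commute)
  have aprox: "aprox f \<phi> x = y"
    unfolding aprox_def
  proof (rule the_equality)
    show "is_minimizer (\<lambda>y. \<phi> y + f (x - y)) y" by (rule min_a)
    fix v assume "is_minimizer (\<lambda>y. \<phi> y + f (x - y)) v"
    then have le: "\<phi> v + f (x - v) \<le> ereal \<kappa>" using val_a unfolding is_minimizer_def by metis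
    then obtain r s where rs: "\<phi> v = ereal r" "f (x - v) = ereal s"
      using ef(3)[of "x - v"] e\<phi>(3)[of v] by (cases "\<phi> v"; cases "f (x - v)") auto
    then have "p \<in> subdiff f (x - v)" using le by (intro p_f[of _ s r]) auto
    then have "x - v = z" using legendre_subdiff_unique[OF leg] pz by blast
    then show "v = y" by (auto simp: y_def)
  qed

  \<comment> \<open>The dual problem and its unique minimizer\<close>
  have val_b: "conjugate \<phi> p + bregman (conjugate f) p u = ereal (c - \<kappa>)"
    unfolding breg conj_p by (simp add: y_def \<kappa>_eq blinfun.diff_right)
  \<comment> \<open>Since \<open>x = z + y\<close>, the lower bound is the sum of the Fenchel--Young
    inequalities at \<open>z\<close> and at \<open>y\<close>. Equality in the sum forces equality in
    the first, so \<open>q\<close> is a subgradient of \<open>f\<close> at \<open>z\<close>, of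
    which \<open>p\<close> is the only one.\<close>
  have lower_b: "ereal (c - \<kappa>) \<le> conjugate \<phi> q + bregman (conjugate f) q u \<and>
      (conjugate \<phi> q + bregman (conjugate f) q u \<le> ereal (c - \<kappa>) \<longrightarrow> q = p)" for q
  proof (cases "conjugate f q = \<infinity> \<or> conjugate \<phi> q = \<infinity>")
    case True
    then have inf: "conjugate \<phi> q + bregman (conjugate f) q u = \<infinity>"
      unfolding breg using efc[of q] e\<phi>c[of q] by (cases "conjugate f q"; cases "conjugate \<phi> q") auto
    show ?thesis unfolding inf by simp
  next
    case False
    then obtain s t where st: "conjugate f q = ereal s" "conjugate \<phi> q = ereal t"
      using efc[of q] e\<phi>c[of q] by (cases "conjugate f q"; cases "conjugate \<phi> q") auto
    have s: "blinfun_apply q z - a \<le> s" using FY_f[of z a q s] ab(1) st(1) by simp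
    have t: "blinfun_apply q y - b \<le> t" using FY_\<phi>[of y b q t] ab(2) st(2) by simp
    have val: "conjugate \<phi> q + bregman (conjugate f) q u = ereal (t + (s - (blinfun_apply q x - c)))"
      unfolding breg st by simp
    have qx: "blinfun_apply q x = blinfun_apply q z + blinfun_apply q y"
      by (simp add: y_def blinfun.diff_right)
    have "q = p" if "t + (s - (blinfun_apply q x - c)) \<le> c - \<kappa>"
    proof -
      have "s \<le> blinfun_apply q z - a" using that t \<kappa>_eq qx by simp
      then have "q \<in> subdiff f z" using st(1) by (intro subdiff_if_conjugate_le[of f, OF ab(1)]) simp
      then show ?thesis using grad_z(2) by simp
    qed
    then show ?thesis unfolding val using s t \<kappa>_eq qx by auto
  qed
  have min_b: "is_minimizer (\<lambda>q. conjugate \<phi> q + bregman (conjugate f) q u) p"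
    unfolding is_minimizer_def val_b using lower_b by blast
  have bprox: "bprox (conjugate f) (conjugate \<phi>) u = p"
    unfolding bprox_def
  proof (rule the_equality)
    show "is_minimizer (\<lambda>q. conjugate \<phi> q + bregman (conjugate f) q u) p" by (rule min_b)
    fix q assume "is_minimizer (\<lambda>q. conjugate \<phi> q + bregman (conjugate f) q u) q"
    then have "conjugate \<phi> q + bregman (conjugate f) q u \<le> ereal (c - \<kappa>)"
      using val_b unfolding is_minimizer_def by metis
    then show "q = p" using lower_b by blast
  qed
  have "inf_conv \<phi> f x = ereal \<kappa>"
    unfolding inf_conv_def using is_minimizer_INF[OF min_a] val_a by simp
  moreover have "bregman_env (conjugate \<phi>) (conjugate f) u = ereal (c - \<kappa>)"
    unfolding bregman_env_def using is_minimizer_INF[OF min_b] val_b by simp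
  \<comment> \<open>Identifies \<open>grad f (x - y)\<close> with \<open>p\<close>, so the last two
    claims are the same Fenchel--Young equality for \<open>\<phi>\<close> at
    \<open>(y, p)\<close>.\<close>
  moreover have "x - y = z" by (simp add: y_def)
  ultimately show ?thesis
    unfolding grad_x(3) aprox bprox grad_p(2)
    using c grad_z(3) conj_p(2) ab(2) by (simp add: y_def)
qed

end
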